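(* Let $B(\alpha)$, $C(\alpha)$ (for $0<\alpha<1/2$) and $V(\alpha)$ be as defined in the context. Then (i) $\lim_{\alpha\searrow0}B(\alpha)=\infty$; (ii) $\lim_{\alpha\searrow0}C(\alpha)=1/2$; (iii) $\lim_{\alpha\searrow0}V(\alpha)=1/\sqrt{2\pi}$.
   Context: Let $W=(W_t)_{t\in[0,1]}$ be standard Brownian motion and $\mathcal{F}=(\mathcal{F}_t)_{t\in[0,1]}$ its natural filtration. For $\alpha>0$ the $\alpha$-Brownian bridge is \[ X^{(\alpha)}_t=\int_0^t\left(\frac{1-t}{1-s}\right)^{\alpha}dW_s,\qquad 0\le t<1, \] which is the unique strong solution of $dX^{(\alpha)}_t=dW_t-\frac{\alpha X^{(\alpha)}_t}{1-t}dt$, $X^{(\alpha)}_0=0$; one has $X^{(\alpha)}_t\to0$ a.s. as $t\to1$, and one sets $X^{(\alpha)}_1=0$. The value of the optimal stopping problem is \[ V(\alpha)=\sup_{0\le\tau\le1}\mathbb{E}X^{(\alpha)}_\tau, \] the supremum being over all $\mathcal{F}$-stopping times $\tau$ with $0\le\tau\le1$. $M(\gamma,\beta,z)=\sum_{n\ge0}\frac{\gamma^{(n)}z^n}{\beta^{(n)}n!}$ is the confluent hypergeometric function of the first kind, where $\gamma^{(0)}=1$, $\gamma^{(n)}=(\gamma+n-1)\gamma^{(n-1)}$. For $0<\alpha<1/2$, put $\gamma(\alpha)=\alpha/(2\alpha-1)$, $z(y,\alpha)=y^2(2\alpha-1)/2$ and, for $y\in\mathbb{R}$, \[ F(y,\alpha)=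 y\,M(\gamma(\alpha),3/2,z(y,\alpha))+\frac{\Gamma(1-\gamma(\alpha))}{\sqrt{2(1-2\alpha)}\,\Gamma(3/2-\gamma(\alpha))}\,M(\gamma(\alpha)-1/2,1/2,z(y,\alpha)). \] $B(\alpha)$ is the (unique) positive solution $B$ of $B=F(B,\alpha)/F'(B,\alpha)$, where $F'=\partial F/\partial y$, and $C(\alpha)$ is determined by $B(\alpha)=C(\alpha)F(B(\alpha),\alpha)$. *)

theory Defs
  imports "HOL-Probability.Probability"
begin

subsection \<open>Brownian motion on the unit time interval\<close>

text \<open>Only the values \<open>W t\<close> with \<open>t \<in> {0..1}\<close> are ever used. The last argument of
  \<^const>\<open>normal_density\<close> is the standard deviation.\<close>

definition brownian_motion :: "'a measure \<Rightarrow> (real \<Rightarrow> 'a \<Rightarrow> real) \<Rightarrow> bool" where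
  "brownian_motion M W \<longleftrightarrow>
     prob_space M \<and>
     (\<forall>t\<in>{0..1}. W t \<in> borel_measurable M) \<and>
     (AE \<omega> in M. W 0 \<omega> = 0) \<and>
     (\<forall>(n::nat) p. mono_on {..n} p \<and> p ` {..n} \<subseteq> {0..1} \<longrightarrow>
        prob_space.indep_vars M (\<lambda>_. borel) (\<lambda>i \<omega>. W (p (Suc i)) \<omega> - W (p i) \<omega>) {..<n}) \<and>
     (\<forall>s t. 0 \<le> s \<and> s < t \<and> t \<le> 1 \<longrightarrow>
        distributed M lborel (\<lambda>\<omega>. W t \<omega> - W s \<omega>) (normal_density 0 (sqrt (t - s)))) \<and>
     (AE \<omega> in M. continuous_on {0..1} (\<lambda>t. W t \<omega>))"

definition natural_filtration :: "'a measure \<Rightarrow> (real \<Rightarrow> 'a \<Rightarrow> real) \<Rightarrow> real \<Rightarrow> 'a measure" where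
  "natural_filtration M W t =
     sigma (space M) {W s -` A \<inter> space M | s A. s \<in> {0..1} \<and> s \<le> t \<and> A \<in> sets borel}"

text \<open>\<^const>\<open>stopping_time\<close> quantifies over all real times, but for a
  \<open>{0..1}\<close>-valued \<open>\<tau>\<close> its condition is trivial at times outside \<open>{0..1}\<close>.\<close>

definition stopping_times :: "'a measure \<Rightarrow> (real \<Rightarrow> 'a \<Rightarrow> real) \<Rightarrow> ('a \<Rightarrow> real) set" where
  "stopping_times M W =
     {\<tau>. stopping_time (natural_filtration M W) \<tau> \<and> (\<forall>\<omega>\<in>space M. 0 \<le> \<tau> \<omega> \<and> \<tau> \<omega> \<le> 1)}"


subsection \<open>The stochastic integral of a deterministic integrand\<close>

definition step_fun :: "nat \<Rightarrow> (nat \<Rightarrow> real) \<Rightarrow> (nat \<Rightarrow> real) \<Rightarrow> real \<Rightarrow> real" where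
  "step_fun n p c s = (\<Sum>i<n. c i * indicator {p i<..p (Suc i)} s)"

definition step_integral ::
  "(real \<Rightarrow> 'a \<Rightarrow> real) \<Rightarrow> nat \<Rightarrow> (nat \<Rightarrow> real) \<Rightarrow> (nat \<Rightarrow> real) \<Rightarrow> 'a \<Rightarrow> real" where
  "step_integral W n p c \<omega> = (\<Sum>i<n. c i * (W (p (Suc i)) \<omega> - W (p i) \<omega>))"

text \<open>\<open>Y\<close> is a version of the Ito integral of \<open>f\<close> over \<open>{0..t}\<close>: the \<open>L\<^sup>2(M)\<close>-limit of the
  integrals of step functions that converge to \<open>f\<close> in \<open>L\<^sup>2({0..t})\<close>. By the Ito isometry, the
  limit exists and does not depend (up to null sets) on the approximating sequence.\<close>

definition has_wiener_integral ::
  "'a measure \<Rightarrow> (real \<Rightarrow> 'a \<Rightarrow> real) \<Rightarrow> (real \<Rightarrow> real) \<Rightarrow> real \<Rightarrow> ('a \<Rightarrow> real) \<Rightarrow> bool" where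
  "has_wiener_integral M W f t Y \<longleftrightarrow>
     set_borel_measurable lborel {0..t} f \<and> Y \<in> borel_measurable M \<and>
     (\<exists>n p c.
        (\<forall>k. mono_on {..n k} (p k) \<and> p k ` {..n k} \<subseteq> {0..t}) \<and>
        (\<lambda>k::nat. \<integral>\<^sup>+s\<in>{0..t}. ennreal ((f s - step_fun (n k) (p k) (c k) s)\<^sup>2) \<partial>lborel)
          \<longlonglongrightarrow> 0 \<and>
        (\<lambda>k. \<integral>\<^sup>+\<omega>. ennreal ((Y \<omega> - step_integral W (n k) (p k) (c k) \<omega>)\<^sup>2) \<partial>M)
          \<longlonglongrightarrow> 0)"


subsection \<open>The \<open>\<alpha>\<close>-Brownian bridge and the optimal stopping value\<close>

text \<open>The stochastic integral is determined only almost surely for each fixed \<open>t\<close>. As usual, the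
  process is a version with continuous paths on \<open>{0..<1}\<close>, and so is unique up to
  indistinguishability.\<close>

definition alpha_bridge ::
  "'a measure \<Rightarrow> (real \<Rightarrow> 'a \<Rightarrow> real) \<Rightarrow> real \<Rightarrow> (real \<Rightarrow> 'a \<Rightarrow> real) \<Rightarrow> bool" where
  "alpha_bridge M W \<alpha> X \<longleftrightarrow>
     (\<forall>t\<in>{0..<1}. has_wiener_integral M W (\<lambda>s. ((1 - t) / (1 - s)) powr \<alpha>) t (X t)) \<and>
     (\<forall>\<omega>\<in>space M. continuous_on {0..<1} (\<lambda>t. X t \<omega>)) \<and>
     (\<forall>\<omega>\<in>space M. X 1 \<omega> = 0)"

text \<open>The supremum is taken in the extended reals, so that it is the true supremum without
  knowing beforehand that it is finite.\<close>

definition stopping_value ::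
  "'a measure \<Rightarrow> (real \<Rightarrow> 'a \<Rightarrow> real) \<Rightarrow> (real \<Rightarrow> 'a \<Rightarrow> real) \<Rightarrow> ereal" where
  "stopping_value M W X = (SUP \<tau>\<in>stopping_times M W. ereal (\<integral>\<omega>. X (\<tau> \<omega>) \<omega> \<partial>M))"


subsection \<open>The functions \<open>F\<close>, \<open>B\<close> and \<open>C\<close>\<close>

definition kummer_M :: "real \<Rightarrow> real \<Rightarrow> real \<Rightarrow> real" where
  "kummer_M \<gamma> \<beta> z = (\<Sum>n. pochhammer \<gamma> n * z ^ n / (pochhammer \<beta> n * fact n))"

definition gam :: "real \<Rightarrow> real" where
  "gam \<alpha> = \<alpha> / (2 * \<alpha> - 1)"

definition zarg :: "real \<Rightarrow> real \<Rightarrow> real" where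
  "zarg y \<alpha> = y\<^sup>2 * (2 * \<alpha> - 1) / 2"

definition F :: "real \<Rightarrow> real \<Rightarrow> real" where
  "F y \<alpha> =
     y * kummer_M (gam \<alpha>) (3/2) (zarg y \<alpha>) +
     Gamma (1 - gam \<alpha>) / (sqrt (2 * (1 - 2 * \<alpha>)) * Gamma (3/2 - gam \<alpha>)) *
       kummer_M (gam \<alpha> - 1/2) (1/2) (zarg y \<alpha>)"

text \<open>If the derivative of \<open>F\<close> vanishes at \<open>b\<close>, the quotient below is \<open>0\<close> by convention, so such a
  \<open>b > 0\<close> is not a solution.\<close>

definition B :: "real \<Rightarrow> real" where
  "B \<alpha> = (THE b. b > 0 \<and> b = F b \<alpha> / deriv (\<lambda>y. F y \<alpha>) b)"

definition C :: "real \<Rightarrow> real" where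
  "C \<alpha> = (THE c. B \<alpha> = c * F (B \<alpha>) \<alpha>)"

end

theory Submission
  imports Defs "HOL-Real_Asymp.Real_Asymp"
begin

text \<open>
  Parts (i) and (ii): \<open>F = F(\<sqdot>, \<alpha>)\<close> solves \<open>F'' + (1 - 2\<alpha>) y F' - F = 0\<close> with \<open>F'(0) = 1\<close> and
  \<open>F(0) \<rightarrow> \<surd>(2/\<pi>)\<close>. The quantity \<open>H = F - y F'\<close>, whose positive zero is \<open>B(\<alpha>)\<close>, satisfies
  \<open>(H exp(y\<^sup>2/2))' = - 2\<alpha> y\<^sup>2 F' exp(y\<^sup>2/2)\<close>, and \<open>(F' exp(- \<alpha> y\<^sup>2))' = H exp(- \<alpha> y\<^sup>2)\<close>. The right-hand
  side of the first identity vanishes with \<open>\<alpha>\<close>, locally uniformly in \<open>y\<close>, so \<open>B(\<alpha>) \<rightarrow> \<infinity>\<close>. It is at most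
  \<open>- 2\<alpha> y\<^sup>2\<close>, so \<open>\<alpha> B(\<alpha>)\<^sup>3\<close> is bounded and \<open>\<alpha> B(\<alpha>)\<^sup>2 \<rightarrow> 0\<close>. The second identity then squeezes
  \<open>F'(B(\<alpha>)) = 1 / C(\<alpha>)\<close> between two expressions tending to \<open>1 + \<surd>(2/\<pi>) \<integral>\<^sub>0\<^sup>\<infinity> exp(- s\<^sup>2/2) ds = 2\<close>.

  Part (iii): for the upper bound, \<open>N\<^sub>t = (1 - t)\<^sup>-\<^sup>\<alpha> X\<^sub>t\<close> is a Gaussian martingale on \<open>[0, 1)\<close> with variance
  at most \<open>1 / (1 - 2\<alpha>)\<close>, and \<open>X\<^sub>\<tau> \<le> N\<^sub>\<tau>\<^sup>+\<close> on \<open>{\<tau> < 1}\<close>, so optional stopping for the submartingale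
  \<open>N\<^sup>+\<close> (discretise \<open>\<tau>\<close> from above, then use Fatou) gives \<open>E X\<^sub>\<tau> \<le> 1 / \<surd>(2\<pi>(1 - 2\<alpha>))\<close>. For the lower bound,
  stop at \<open>1 - \<alpha>\<close> if \<open>W\<close> is positive there and at \<open>1\<close> otherwise; \<open>X\<close> and \<open>W\<close> are close at time \<open>1 - \<alpha>\<close>
  in \<open>L\<^sup>2\<close> by the Ito isometry.
\<close>


section \<open>The differential equation of F\<close>

definition kummer_coeff :: "real \<Rightarrow> real \<Rightarrow> nat \<Rightarrow> real" where
  "kummer_coeff a b n = pochhammer a n / (pochhammer b n * fact n)"

lemma kummer_M_eq: "kummer_M a b z = (\<Sum>n. kummer_coeff a b n * z ^ n)"
  by (simp add: kummer_M_def kummer_coeff_def)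

text \<open>The ratio of consecutive coefficients with the denominators cleared. It feeds both the
  ratio test and the coefficientwise proof of Kummer's equation.\<close>

lemma kummer_coeff_Suc:
  assumes "b > 0"
  shows "(real n + b) * (real n + 1) * kummer_coeff a b (Suc n) = (real n + a) * kummer_coeff a b n"
proof -
  have "pochhammer b n > 0"
    using assms by (rule pochhammer_pos)
  moreover have "b + real n > 0"
    using assms by simp
  ultimately show ?thesis
    unfolding kummer_coeff_def pochhammer_Suc fact_Suc by (simp add: divide_simps) (simp add: algebra_simps)
qed

lemma summable_kummer:
  assumes "b > 0"
  shows "summable (\<lambda>n. kummer_coeff a b n * z ^ n)"
proof -
  \<comment> \<open>\<open>q\<close> bounds \<open>\<bar>n + a\<bar> / (n + b)\<close> for all
    \<open>n\<close>, so consecutive terms have ratio at most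
    \<open>q \<bar>z\<bar> / (n + 1)\<close>, which is at most 1/2 from index \<open>N\<close>
    on.\<close>
  define q where "q = \<bar>a\<bar> / b + 1"
  have q: "\<bar>real n + a\<bar> \<le> q * (real n + b)" for n
  proof -
    have "q * (real n + b) = \<bar>a\<bar> + real n + b + \<bar>a\<bar> * real n / b"
      using assms by (simp add: q_def field_simps)
    moreover have "\<bar>a\<bar> * real n / b \<ge> 0"
      using assms by simp
    ultimately show ?thesis
      using assms by linarith
  qed
  obtain N :: nat where N: "2 * q * \<bar>z\<bar> \<le> real N"
    using real_arch_simple by blast
  show ?thesis
  proof (rule summable_ratio_test[where c = "1/2" and N = N])
    fix n assume "n \<ge> N"
    hence n: "2 * q * \<bar>z\<bar> \<le> real n + 1"
      using N by linarith
    define c where "c = \<bar>kummer_coeff a b n\<bar>"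
    define d where "d = \<bar>kummer_coeff a b (Suc n)\<bar>"
    have nb: "real n + b > 0"
      using assms by linarith
    have "(real n + b) * (real n + 1) * d = \<bar>real n + a\<bar> * c"
      using arg_cong[OF kummer_coeff_Suc[OF assms, of n a], of abs] nb
      by (simp add: abs_mult c_def d_def)
    also have "\<dots> \<le> q * (real n + b) * c"
      using q by (intro mult_right_mono) (auto simp: c_def)
    finally have "(real n + b) * ((real n + 1) * d) \<le> (real n + b) * (q * c)"
      by (simp add: mult_ac)
    hence *: "(real n + 1) * d \<le> q * c"
      using nb by simp
    have "(real n + 1) * (d * \<bar>z\<bar>) \<le> q * c * \<bar>z\<bar>"
      using mult_right_mono[OF *, of "\<bar>z\<bar>"] by (simp add: mult_ac)
    also have "\<dots> = (q * \<bar>z\<bar>) * c"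
      by simp
    also have "\<dots> \<le> ((real n + 1) / 2) * c"
      using n by (intro mult_right_mono) (auto simp: c_def)
    finally have "(real n + 1) * (d * \<bar>z\<bar>) \<le> (real n + 1) * (c / 2)"
      by (simp add: mult_ac)
    hence "d * \<bar>z\<bar> \<le> c / 2"
      by simp
    from mult_right_mono[OF this, of "\<bar>z\<bar> ^ n"]
    show "norm (kummer_coeff a b (Suc n) * z ^ Suc n) \<le> 1/2 * norm (kummer_coeff a b n * z ^ n)"
      by (simp add: abs_mult power_abs c_def d_def mult_ac)
  qed simp
qed

lemma diffs_kummer_coeff:
  assumes "b > 0"
  shows "diffs (kummer_coeff a b) = (\<lambda>n. a / b * kummer_coeff (a + 1) (b + 1) n)"
proof
  fix n
  have "pochhammer (b + 1) n > 0"
    using assms by (intro pochhammer_pos) simp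
  thus "diffs (kummer_coeff a b) n = a / b * kummer_coeff (a + 1) (b + 1) n"
    using assms
    unfolding diffs_def kummer_coeff_def pochhammer_rec fact_Suc by (simp add: divide_simps)
qed

lemma kummer_M_has_derivative:
  assumes "b > 0"
  shows "(kummer_M a b has_real_derivative a / b * kummer_M (a + 1) (b + 1) z) (at z)"
proof -
  have "((\<lambda>z. \<Sum>n. kummer_coeff a b n * z ^ n) has_real_derivative
          (\<Sum>n. diffs (kummer_coeff a b) n * z ^ n)) (at z)"
    by (rule termdiffs_strong_converges_everywhere) (rule summable_kummer[OF assms])
  moreover have "(\<Sum>n. diffs (kummer_coeff a b) n * z ^ n) = a / b * kummer_M (a + 1) (b + 1) z"
    using summable_kummer[of "b + 1" "a + 1" z] assms
    by (simp add: diffs_kummer_coeff[OF assms] kummer_M_eq mult.assoc suminf_mult[symmetric] del: times_divide_eq_left)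
  moreover have "(\<lambda>z. \<Sum>n. kummer_coeff a b n * z ^ n) = kummer_M a b"
    by (simp add: kummer_M_eq fun_eq_iff)
  ultimately show ?thesis
    by simp
qed

lemma kummer_M_0 [simp]: "kummer_M a b 0 = 1"
  unfolding kummer_M_eq by (subst powser_zero) (simp add: kummer_coeff_def)

text \<open>Kummer's equation \<open>z w'' + (b - z) w' = a w\<close>, with \<open>M1\<close> and
  \<open>M2\<close> the values of \<open>w'\<close> and \<open>w''\<close> at \<open>z\<close>.
  Coefficient by coefficient it is the recursion \<open>kummer_coeff_Suc\<close>.\<close>

lemma kummer_M_ode:
  fixes a b z :: real
  assumes "b > 0"
  defines "M1 \<equiv> a / b * kummer_M (a + 1) (b + 1) z"
  defines "M2 \<equiv> a / b * ((a + 1) / (b + 1) * kummer_M (a + 2) (b + 2) z)"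
  shows "z * M2 + (b - z) * M1 = a * kummer_M a b z"
proof -
  let ?c = "kummer_coeff a b" and ?c1 = "\<lambda>n. a / b * kummer_coeff (a + 1) (b + 1) n"
  have s0: "(\<lambda>n. ?c n * z ^ n) sums kummer_M a b z"
    using summable_kummer[OF assms(1)] unfolding kummer_M_eq by (rule summable_sums)
  have s1: "(\<lambda>n. ?c1 n * z ^ n) sums M1"
    using summable_sums[OF summable_kummer[of "b + 1" "a + 1" z], THEN sums_mult, of "a / b"] assms
    by (simp add: kummer_M_eq M1_def mult_ac)
  have "(\<lambda>n. diffs ?c1 n * z ^ n) sums M2"
  proof -
    have "diffs ?c1 = (\<lambda>n. a / b * ((a + 1) / (b + 1) * kummer_coeff (a + 2) (b + 2) n))"
    proof
      fix n
      have "diffs ?c1 n = a / b * diffs (kummer_coeff (a + 1) (b + 1)) n"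
        by (simp add: diffs_def)
      thus "diffs ?c1 n = a / b * ((a + 1) / (b + 1) * kummer_coeff (a + 2) (b + 2) n)"
        using assms(1) by (subst (asm) diffs_kummer_coeff) (simp_all add: add.assoc)
    qed
    thus ?thesis
      using summable_sums[OF summable_kummer[of "b + 2" "a + 2" z], THEN sums_mult,
          of "a / b * ((a + 1) / (b + 1))"] assms
      by (simp add: kummer_M_eq M2_def mult.assoc)
  qed
  \<comment> \<open>The factor \<open>z\<close> undoes the index shift of differentiation, so that
    all the series to be combined run over the same powers \<open>z ^ n\<close>.\<close>
  have deriv_sums: "(\<lambda>n. real n * c n * z ^ n) sums (z * s)"
    if "(\<lambda>n. diffs c n * z ^ n) sums s" for c :: "nat \<Rightarrow> real" and s
  proof -
    have "(\<lambda>n. real n * c n * z ^ (n - Suc 0)) sums s"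
      using diffs_equiv[of c z] that by (simp add: sums_iff)
    hence "(\<lambda>n. z * (real n * c n * z ^ (n - Suc 0))) sums (z * s)"
      by (rule sums_mult)
    moreover have "z * (real n * c n * z ^ (n - Suc 0)) = real n * c n * z ^ n" for n
      by (cases n) auto
    ultimately show ?thesis by simp
  qed
  have c1: "?c1 n = (real n + 1) * ?c (Suc n)" for n
    using fun_cong[OF diffs_kummer_coeff[OF assms(1), of a], of n] by (simp add: diffs_def add.commute)
  have "(\<lambda>n. real n * ?c1 n * z ^ n) sums (z * M2)"
    by (rule deriv_sums) fact
  moreover have "(\<lambda>n. real n * ?c n * z ^ n) sums (z * M1)"
    using s1 by (intro deriv_sums) (simp add: diffs_kummer_coeff[OF assms(1)])
  ultimately have "(\<lambda>n. real n * ?c1 n * z ^ n + b * (?c1 n * z ^ n) -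
      (real n * ?c n * z ^ n + a * (?c n * z ^ n))) sums (z * M2 + b * M1 - (z * M1 + a * kummer_M a b z))"
    using s0 s1 by (intro sums_diff sums_add sums_mult)
  moreover have "real n * ?c1 n * z ^ n + b * (?c1 n * z ^ n) -
      (real n * ?c n * z ^ n + a * (?c n * z ^ n)) = 0" for n
  proof -
    have "real n * ?c1 n * z ^ n + b * (?c1 n * z ^ n) - (real n * ?c n * z ^ n + a * (?c n * z ^ n))
       = ((real n + b) * (real n + 1) * ?c (Suc n) - (real n + a) * ?c n) * z ^ n"
      unfolding c1 by (simp add: algebra_simps)
    thus ?thesis by (simp add: kummer_coeff_Suc[OF assms(1)])
  qed
  ultimately have "(\<lambda>n. 0) sums (z * M2 + b * M1 - (z * M1 + a * kummer_M a b z))"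
    by simp
  hence "z * M2 + b * M1 - (z * M1 + a * kummer_M a b z) = 0"
    using sums_unique2 sums_zero by blast
  thus ?thesis by (simp add: algebra_simps)
qed

section \<open>From Kummer's equation to the equation of \<open>F\<close>, and the limit of
  \<open>F(0)\<close>\<close>

definition F0 :: "real \<Rightarrow> real" where
  "F0 \<alpha> = Gamma (1 - gam \<alpha>) / (sqrt (2 * (1 - 2 * \<alpha>)) * Gamma (3/2 - gam \<alpha>))"

definition F' :: "real \<Rightarrow> real \<Rightarrow> real" where
  "F' y \<alpha> = deriv (\<lambda>y. F y \<alpha>) y"

text \<open>In the variable \<open>zarg y \<alpha>\<close>, the functions
  \<open>y M(gam, 3/2, .)\<close> and \<open>M(gam - 1/2, 1/2, .)\<close> are an odd and an even
  solution of \<open>u'' + (1 - 2\<alpha>) y u' = u\<close>, and \<open>F\<close> is a linear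
  combination of the two.\<close>

lemma
  assumes "\<alpha> < 1/2"
  shows F_has_derivative: "((\<lambda>y. F y \<alpha>) has_real_derivative F' y \<alpha>) (at y)"
    and F'_has_derivative:
      "((\<lambda>y. F' y \<alpha>) has_real_derivative F y \<alpha> - (1 - 2 * \<alpha>) * y * F' y \<alpha>) (at y)"
    and F'_0: "F' 0 \<alpha> = 1"
proof -
  define k where "k = 1 - 2 * \<alpha>"
  define g where "g = gam \<alpha>"
  define Z where "Z = (\<lambda>y. zarg y \<alpha>)"
  have k: "k > 0" and kg: "k * g = - \<alpha>" and k2: "k = 1 - 2 * \<alpha>"
    using assms by (auto simp: k_def g_def gam_def field_simps)
  have Z: "(Z has_real_derivative - k * y) (at y)" for y
    unfolding Z_def zarg_def k_def by (auto intro!: derivative_eq_intros simp: field_simps)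
  have Z_eq: "k * y\<^sup>2 = - 2 * Z y" for y
    by (simp add: Z_def zarg_def k_def field_simps)
  \<comment> \<open>Differentiating raises both Kummer parameters by one, up to a factor.
    \<open>K i\<close> and \<open>L i\<close> are the shifted functions; the factors
    \<open>k1\<close>, \<open>k2\<close>, \<open>l1\<close>, \<open>l2\<close> stay folded to keep
    the algebra manageable.\<close>
  define K where "K = (\<lambda>i z. kummer_M (g + i) (3/2 + i) z)"
  define L where "L = (\<lambda>i z. kummer_M (g - 1/2 + i) (1/2 + i) z)"
  have KZ: "((\<lambda>y. K i (Z y)) has_real_derivative (g + i) / (3/2 + i) * K (i + 1) (Z y) * (- k * y)) (at y)"
    if "i \<ge> 0" for i y
    using DERIV_chain2[OF kummer_M_has_derivative[of "3/2 + i" "g + i"] Z] that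
    by (simp add: K_def add.assoc)
  have LZ: "((\<lambda>y. L i (Z y)) has_real_derivative (g - 1/2 + i) / (1/2 + i) * L (i + 1) (Z y) * (- k * y)) (at y)"
    if "i \<ge> 0" for i y
    using DERIV_chain2[OF kummer_M_has_derivative[of "1/2 + i" "g - 1/2 + i"] Z] that
    by (simp add: L_def add.assoc)
  define k1 where "k1 = g / (3/2)"
  define k2 where "k2 = (g + 1) / (3/2 + 1)"
  define l1 where "l1 = (g - 1/2) / (1/2)"
  define l2 where "l2 = (g - 1/2 + 1) / (1/2 + 1)"
  have K0: "((\<lambda>y. K 0 (Z y)) has_real_derivative k1 * K 1 (Z y) * (- k * y)) (at y)"
    and K1: "((\<lambda>y. K 1 (Z y)) has_real_derivative k2 * K 2 (Z y) * (- k * y)) (at y)"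
    and L0: "((\<lambda>y. L 0 (Z y)) has_real_derivative l1 * L 1 (Z y) * (- k * y)) (at y)"
    and L1: "((\<lambda>y. L 1 (Z y)) has_real_derivative l2 * L 2 (Z y) * (- k * y)) (at y)" for y
    using KZ[of 0 y] KZ[of 1 y] LZ[of 0 y] LZ[of 1 y]
    unfolding k1_def k2_def l1_def l2_def by simp_all
  have lin: "((\<lambda>y. - k * y) has_real_derivative - k) (at y)" for y
    using DERIV_cmult[OF DERIV_ident, of "-k"] by simp
  have F_eq: "F y \<alpha> = y * K 0 (Z y) + F0 \<alpha> * L 0 (Z y)" for y
    by (simp add: F_def K_def L_def Z_def g_def F0_def)
  define D where "D = (\<lambda>y. K 0 (Z y) + y * (k1 * K 1 (Z y) * (- k * y)) + F0 \<alpha> * (l1 * L 1 (Z y) * (- k * y)))"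
  have D: "((\<lambda>y. F y \<alpha>) has_real_derivative D y) (at y)" for y
    unfolding F_eq D_def
    by (rule DERIV_cong[OF DERIV_add[OF DERIV_mult[OF DERIV_ident K0] DERIV_cmult[OF L0]]])
      (simp add: algebra_simps)
  have F'_eq: "F' y \<alpha> = D y" for y
    unfolding F'_def by (rule DERIV_imp_deriv[OF D])
  show "((\<lambda>y. F y \<alpha>) has_real_derivative F' y \<alpha>) (at y)"
    using D by (simp add: F'_eq)
  show "F' 0 \<alpha> = 1"
    by (simp add: F'_eq D_def K_def Z_def zarg_def)
  define D2 where "D2 = k1 * K 1 (Z y) * (- k * y) + (k1 * K 1 (Z y) * (- k * y)
     + y * (k1 * (k2 * K 2 (Z y) * (- k * y)) * (- k * y) + k1 * K 1 (Z y) * (- k)))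
     + F0 \<alpha> * (l1 * (l2 * L 2 (Z y) * (- k * y)) * (- k * y) + l1 * L 1 (Z y) * (- k))"
  have D2: "(D has_real_derivative D2) (at y)"
    unfolding D_def D2_def
    by (rule DERIV_cong[OF DERIV_add[OF DERIV_add[OF K0 DERIV_mult[OF DERIV_ident
          DERIV_mult[OF DERIV_cmult[OF K1] lin]]] DERIV_cmult[OF DERIV_mult[OF DERIV_cmult[OF L1] lin]]]])
      (simp add: algebra_simps)
  have odeK: "Z y * (k1 * (k2 * K 2 (Z y))) + (3/2 - Z y) * (k1 * K 1 (Z y)) = g * K 0 (Z y)"
    using kummer_M_ode[of "3/2" "Z y" g] by (simp add: K_def k1_def k2_def add.commute)
  have odeL: "Z y * (l1 * (l2 * L 2 (Z y))) + (1/2 - Z y) * (l1 * L 1 (Z y)) = (g - 1/2) * L 0 (Z y)"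
    using kummer_M_ode[of "1/2" "Z y" "g - 1/2"] by (simp add: L_def l1_def l2_def algebra_simps)
  \<comment> \<open>The terms with \<open>K\<close> and those with \<open>L\<close> vanish
    separately: after \<open>k y\<^sup>2 = - 2 z\<close>, Kummer's equation leaves in each case a
    multiple of \<open>- 2 k g + k - 1\<close>, which is 0 because
    \<open>k g = - \<alpha>\<close>.\<close>
  have "D2 + k * y * D y - F y \<alpha> = 0"
  proof -
    let ?z = "Z y"
    have z: "y * y * k = - 2 * ?z"
      using Z_eq[of y] by (simp add: power2_eq_square mult_ac)
    have K: "- 3 * k * y * (k1 * K 1 ?z) + y * (k * (y * y * k)) * (k1 * (k2 * K 2 ?z)) + k * y * K 0 ?z - k * y * (y * y * k) * (k1 * K 1 ?z) - y * K 0 ?z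
       = 0"
    proof -
      have "- 3 * k * y * (k1 * K 1 ?z) + y * (k * (y * y * k)) * (k1 * (k2 * K 2 ?z)) + k * y * K 0 ?z - k * y * (y * y * k) * (k1 * K 1 ?z) - y * K 0 ?z
         = - 2 * k * y * (?z * (k1 * (k2 * K 2 ?z)) + (3/2 - ?z) * (k1 * K 1 ?z)) + (k - 1) * y * K 0 ?z"
        unfolding z by (simp add: algebra_simps)
      also have "\<dots> = (- 2 * (k * g) + k - 1) * y * K 0 ?z"
        unfolding odeK by (simp add: algebra_simps)
      also have "\<dots> = 0"
        unfolding kg by (simp add: k_def)
      finally show ?thesis .
    qed
    have L: "(y * y * k) * k * (l1 * (l2 * L 2 ?z)) - k * (l1 * L 1 ?z) - k * (y * y * k) * (l1 * L 1 ?z) - L 0 ?z = 0"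
    proof -
      have "(y * y * k) * k * (l1 * (l2 * L 2 ?z)) - k * (l1 * L 1 ?z) - k * (y * y * k) * (l1 * L 1 ?z) - L 0 ?z
         = - 2 * k * (?z * (l1 * (l2 * L 2 ?z)) + (1/2 - ?z) * (l1 * L 1 ?z)) - L 0 ?z"
        unfolding z by (simp add: algebra_simps)
      also have "\<dots> = (- 2 * (k * g) + k - 1) * L 0 ?z"
        unfolding odeL by (simp add: algebra_simps)
      also have "\<dots> = 0"
        unfolding kg by (simp add: k_def)
      finally show ?thesis .
    qed
    have "D2 + k * y * D y - F y \<alpha> =
      (- 3 * k * y * (k1 * K 1 ?z) + y * (k * (y * y * k)) * (k1 * (k2 * K 2 ?z)) + k * y * K 0 ?z - k * y * (y * y * k) * (k1 * K 1 ?z) - y * K 0 ?z)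
      + F0 \<alpha> * ((y * y * k) * k * (l1 * (l2 * L 2 ?z)) - k * (l1 * L 1 ?z) - k * (y * y * k) * (l1 * L 1 ?z) - L 0 ?z)"
      unfolding D2_def D_def F_eq by (simp add: algebra_simps)
    thus ?thesis unfolding K L by simp
  qed
  hence "D2 = F y \<alpha> - (1 - 2 * \<alpha>) * y * F' y \<alpha>"
    by (simp add: F'_eq k_def)
  thus "((\<lambda>y. F' y \<alpha>) has_real_derivative F y \<alpha> - (1 - 2 * \<alpha>) * y * F' y \<alpha>) (at y)"
    using D2 by (simp add: F'_eq)
qed

lemma F_0: "F 0 \<alpha> = F0 \<alpha>"
  by (simp add: F_def F0_def zarg_def)

lemma F0_pos:
  assumes "0 < \<alpha>" "\<alpha> < 1/2"
  shows "F0 \<alpha> > 0"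
proof -
  have "gam \<alpha> < 0"
    using assms by (simp add: gam_def field_simps)
  thus ?thesis
    using assms unfolding F0_def by (intro divide_pos_pos mult_pos_pos Gamma_real_pos) auto
qed

text \<open>\<open>gam \<alpha>\<close> tends to 0, so the limit is
  \<open>Gamma 1 / (sqrt 2 * Gamma (3/2))\<close>, where
  \<open>Gamma (3/2) = sqrt pi / 2\<close>.\<close>

lemma F0_tendsto: "(F0 \<longlongrightarrow> sqrt (2 / pi)) (at_right 0)"
proof -
  have g: "(gam \<longlongrightarrow> 0) (at_right 0)"
    unfolding gam_def by (auto intro!: tendsto_eq_intros)
  have nz: "(3/2 :: real) \<notin> \<int>\<^sub>\<le>\<^sub>0" "(1/2 :: real) \<notin> \<int>\<^sub>\<le>\<^sub>0" "(1::real) \<notin> \<int>\<^sub>\<le>\<^sub>0"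
    by (auto elim!: nonpos_Ints_cases)
  have "(F0 \<longlongrightarrow> Gamma (1 - 0) / (sqrt (2 * (1 - 2 * 0)) * Gamma (3/2 - 0 :: real))) (at_right 0)"
    unfolding F0_def using nz by (intro tendsto_intros g) (auto simp: Gamma_eq_zero_iff)
  moreover have "Gamma (3/2 :: real) = sqrt pi / 2"
    using Gamma_plus1[OF nz(2)] Gamma_one_half_real by simp
  moreover have "2 / (sqrt 2 * sqrt pi) = sqrt (2 / pi)"
    by (simp add: real_sqrt_divide field_simps)
  ultimately show ?thesis
    by simp
qed

section \<open>Asymptotics of B and C\<close>

text \<open>The analysis of the root uses only the initial value problem, so the Kummer and Gamma
  functions are abstracted away: \<open>f\<close> stands for \<open>F(., \<alpha>)\<close> and
  \<open>A\<close> for \<open>F(0, \<alpha>)\<close>.\<close>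

locale F_ode =
  fixes \<alpha> A :: real and f f' :: "real \<Rightarrow> real"
  assumes \<alpha>: "0 < \<alpha>" "\<alpha> < 1/2" and A: "A > 0"
    and f_0: "f 0 = A" and f'_0: "f' 0 = 1"
    and f: "(f has_real_derivative f' y) (at y)"
    and f': "(f' has_real_derivative f y - (1 - 2 * \<alpha>) * y * f' y) (at y)"
begin

section \<open>Signs and bounds for the solution of the initial value problem\<close>

definition f'' :: "real \<Rightarrow> real" where
  "f'' y = f y - (1 - 2 * \<alpha>) * y * f' y"

lemma f'_f'': "(f' has_real_derivative f'' y) (at y)"
  using f' by (simp add: f''_def)

text \<open>Differentiating the equation gives
  \<open>f''' + (1 - 2\<alpha>) y f'' = 2\<alpha> f'\<close>, and the exponential is the integrating
  factor. Hence \<open>E\<close> increases as long as \<open>f'\<close> is positive.\<close>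

definition E :: "real \<Rightarrow> real" where
  "E y = exp ((1 - 2 * \<alpha>) * y\<^sup>2 / 2) * f'' y"

lemma E_has_derivative:
  "(E has_real_derivative 2 * \<alpha> * f' y * exp ((1 - 2 * \<alpha>) * y\<^sup>2 / 2)) (at y)"
  unfolding E_def f''_def
  by (auto intro!: derivative_eq_intros f f') (simp add: algebra_simps power2_eq_square)

lemma E_mono:
  assumes "0 \<le> y" and "\<And>x. 0 < x \<Longrightarrow> x < y \<Longrightarrow> f' x > 0"
  shows "A \<le> E y"
proof (cases "y = 0")
  case True
  thus ?thesis by (simp add: E_def f''_def f_0)
next
  case False
  have "E 0 \<le> E y"
  proof (rule DERIV_nonneg_imp_increasing_open[where f = E])
    show "\<exists>d. DERIV E x :> d \<and> 0 \<le> d" if "0 < x" "x < y" for x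
      using E_has_derivative[of x] assms(2)[OF that] \<alpha> by (intro exI conjI) auto
    show "continuous_on {0..y} E"
      using E_has_derivative DERIV_isCont by (intro continuous_at_imp_continuous_on) blast
  qed (use assms in auto)
  thus ?thesis by (simp add: E_def f''_def f_0)
qed

text \<open>Follows from \<open>E y \<ge> E 0 = A\<close>; the exponent is weakened to make the
  Gaussian factor independent of \<alpha>. The positivity assumption is discharged later by
  \<open>f'_pos\<close>.\<close>

lemma f''_ge_aux:
  assumes "0 \<le> y" and "\<And>x. 0 < x \<Longrightarrow> x < y \<Longrightarrow> f' x > 0"
  shows "f'' y \<ge> A * exp (- y\<^sup>2 / 2)"
proof -
  have "A * exp (- y\<^sup>2 / 2) \<le> A * exp (- ((1 - 2 * \<alpha>) * y\<^sup>2 / 2))"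
    using A \<alpha> by (intro mult_left_mono) (auto simp: field_simps)
  also have "\<dots> \<le> E y * exp (- ((1 - 2 * \<alpha>) * y\<^sup>2 / 2))"
    using E_mono[OF assms] by (intro mult_right_mono) auto
  also have "\<dots> = f'' y"
    by (simp add: E_def exp_minus field_simps)
  finally show ?thesis .
qed

text \<open>Continuation argument: let \<open>z\<close> be the first point where \<open>f'\<close>
  fails to be positive. Then \<open>f''\<close> is nonnegative on \<open>[0, z]\<close>, so
  \<open>f' z \<ge> f' 0 = 1\<close>, a contradiction.\<close>

lemma f'_pos:
  assumes "y \<ge> 0"
  shows "f' y > 0"
proof (rule ccontr)
  assume "\<not> f' y > 0"
  define S where "S = {x \<in> {0..y}. f' x \<le> 0}"
  define z where "z = Inf S"
  have cont: "continuous_on {0..y} f'"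
    using f' DERIV_isCont by (intro continuous_at_imp_continuous_on) blast
  have "closed S"
    unfolding S_def using continuous_on_closed_Collect_le[OF cont continuous_on_const] by auto
  moreover have "S \<noteq> {}" "bdd_below S"
    using assms \<open>\<not> f' y > 0\<close> by (auto simp: S_def intro!: bdd_belowI[of _ 0])
  ultimately have z: "z \<in> S"
    unfolding z_def by (intro closed_contains_Inf)
  have pos: "f' x > 0" if "0 \<le> x" "x < z" for x
  proof -
    have "x \<notin> S"
      using that cInf_lower[OF _ \<open>bdd_below S\<close>] unfolding z_def by fastforce
    thus ?thesis
      using that z by (auto simp: S_def)
  qed
  have "f' 0 \<le> f' z"
  proof (rule DERIV_nonneg_imp_nondecreasing[where f = f'])
    fix x assume x: "0 \<le> x" "x \<le> z"
    have "0 \<le> A * exp (- x\<^sup>2 / 2)"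
      using A by simp
    also have "\<dots> \<le> f'' x"
      using x pos by (intro f''_ge_aux) auto
    finally show "\<exists>d. DERIV f' x :> d \<and> 0 \<le> d"
      using f'_f'' by blast
  qed (use z in \<open>auto simp: S_def\<close>)
  thus False
    using z f'_0 by (auto simp: S_def)
qed

lemma f''_ge: "y \<ge> 0 \<Longrightarrow> f'' y \<ge> A * exp (- y\<^sup>2 / 2)"
  using f'_pos by (intro f''_ge_aux) auto

lemma f''_pos: "y \<ge> 0 \<Longrightarrow> f'' y > 0"
  using f''_ge[of y] A by (meson exp_gt_zero less_le_trans mult_pos_pos)

lemma f'_ge_1:
  assumes "y \<ge> 0"
  shows "f' y \<ge> 1"
proof -
  have "f' 0 \<le> f' y"
    using assms f'_f'' f''_pos by (intro DERIV_nonneg_imp_nondecreasing[where f = f']) (auto intro: less_imp_le)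
  thus ?thesis by (simp add: f'_0)
qed

text \<open>Since \<open>f'\<close> is positive, the positive zeros of \<open>H\<close> are the
  positive solutions of \<open>b = f b / f' b\<close>. Geometrically, \<open>H y\<close> is the
  intercept of the tangent at \<open>y\<close>, which decreases because \<open>f\<close> is convex
  on \<open>[0, \<infinity>)\<close>.\<close>

definition H :: "real \<Rightarrow> real" where
  "H y = f y - y * f' y"

lemma f''_eq: "f'' y = H y + 2 * \<alpha> * y * f' y"
  by (simp add: f''_def H_def algebra_simps)

lemma H_has_derivative: "(H has_real_derivative - y * f'' y) (at y)"
  unfolding H_def by (auto intro!: derivative_eq_intros f f'_f'')

lemma H_0: "H 0 = A"
  by (simp add: H_def f_0)

lemma H_strict_antimono:
  assumes "0 \<le> x" "x < y"
  shows "H y < H x"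
proof (rule DERIV_neg_imp_decreasing_open[OF assms(2), where f = H])
  show "\<exists>d. DERIV H z :> d \<and> d < 0" if "x < z" "z < y" for z
    using H_has_derivative[of z] f''_pos[of z] that assms by (intro exI conjI) auto
  show "continuous_on {x..y} H"
    using H_has_derivative DERIV_isCont by (intro continuous_at_imp_continuous_on) blast
qed

text \<open>\<open>f'' = H + 2\<alpha> y f'\<close> turns \<open>H' = - y f''\<close> into
  \<open>H' + y H = - 2\<alpha> y\<^sup>2 f'\<close>, and the exponential is the integrating factor.
  \<open>G\<close> has the sign of \<open>H\<close>.\<close>

definition G :: "real \<Rightarrow> real" where
  "G y = H y * exp (y\<^sup>2 / 2)"

lemma G_has_derivative:
  "(G has_real_derivative - (2 * \<alpha> * y\<^sup>2 * f' y * exp (y\<^sup>2 / 2))) (at y)"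
  unfolding G_def
  by (auto intro!: derivative_eq_intros H_has_derivative)
     (simp add: f''_eq algebra_simps power2_eq_square)

lemma G_0: "G 0 = A"
  by (simp add: G_def H_0)

text \<open>With \<open>f' \<ge> 1\<close> and \<open>exp (y\<^sup>2 / 2) \<ge> 1\<close>, the
  derivative of \<open>G\<close> is at most \<open>- 2\<alpha> y\<^sup>2\<close>. At a root this
  bounds \<open>\<alpha> b ^ 3\<close>.\<close>

lemma G_le:
  assumes "y \<ge> 0"
  shows "G y + 2 / 3 * \<alpha> * y ^ 3 \<le> A"
proof -
  have "G y + 2 / 3 * \<alpha> * y ^ 3 \<le> G 0 + 2 / 3 * \<alpha> * 0 ^ 3"
  proof (rule DERIV_nonpos_imp_nonincreasing[OF assms, where f = "\<lambda>y. G y + 2 / 3 * \<alpha> * y ^ 3"])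
    fix x :: real assume x: "0 \<le> x" "x \<le> y"
    have d: "((\<lambda>y. G y + 2 / 3 * \<alpha> * y ^ 3) has_real_derivative
        - (2 * \<alpha> * x\<^sup>2 * f' x * exp (x\<^sup>2 / 2)) + 2 * \<alpha> * x\<^sup>2) (at x)"
      by (auto intro!: derivative_eq_intros G_has_derivative)
    have "1 * 1 \<le> f' x * exp (x\<^sup>2 / 2)"
      using x f'_ge_1[of x] by (intro mult_mono) auto
    hence "2 * \<alpha> * x\<^sup>2 * 1 \<le> 2 * \<alpha> * x\<^sup>2 * (f' x * exp (x\<^sup>2 / 2))"
      using \<alpha> by (intro mult_left_mono) auto
    thus "\<exists>d. ((\<lambda>y. G y + 2 / 3 * \<alpha> * y ^ 3) has_real_derivative d) (at x) \<and> d \<le> 0"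
      using d by (intro exI conjI) (auto simp: mult.assoc)
  qed
  thus ?thesis by (simp add: G_0)
qed

text \<open>The equation in the form \<open>f'' - 2\<alpha> y f' = H\<close>, multiplied by its
  integrating factor.\<close>

lemma f'_exp_has_derivative:
  "((\<lambda>y. f' y * exp (- (\<alpha> * y\<^sup>2))) has_real_derivative H y * exp (- (\<alpha> * y\<^sup>2))) (at y)"
  by (auto intro!: derivative_eq_intros f'_f'') (simp add: f''_eq algebra_simps power2_eq_square)

text \<open>Integrates the preceding identity with \<open>H \<le> H 0 = A\<close>. The bound is
  crude for large \<open>y\<close> but suffices on a fixed interval \<open>[0, K]\<close>.\<close>

lemma f'_le:
  assumes "y \<ge> 0"
  shows "f' y \<le> exp (\<alpha> * y\<^sup>2) * (1 + A * y)"
proof -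
  have "f' y * exp (- (\<alpha> * y\<^sup>2)) - A * y \<le> f' 0 * exp (- (\<alpha> * 0\<^sup>2)) - A * 0"
  proof (rule DERIV_nonpos_imp_nonincreasing[OF assms, where f = "\<lambda>y. f' y * exp (- (\<alpha> * y\<^sup>2)) - A * y"])
    fix x assume x: "0 \<le> x" "x \<le> y"
    have "((\<lambda>y. f' y * exp (- (\<alpha> * y\<^sup>2)) - A * y) has_real_derivative H x * exp (- (\<alpha> * x\<^sup>2)) - A) (at x)"
      by (rule DERIV_diff[OF f'_exp_has_derivative DERIV_cmult_Id])
    moreover have "H x * exp (- (\<alpha> * x\<^sup>2)) \<le> A * 1"
    proof (rule mult_mono)
      show "H x \<le> A"
        using H_strict_antimono[of 0 x] x H_0 by (cases "x = 0") auto
    qed (use A \<alpha> in auto)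
    ultimately show "\<exists>d. ((\<lambda>y. f' y * exp (- (\<alpha> * y\<^sup>2)) - A * y) has_real_derivative d) (at x) \<and> d \<le> 0"
      by force
  qed
  hence "f' y * exp (- (\<alpha> * y\<^sup>2)) \<le> 1 + A * y"
    by (simp add: f'_0)
  hence "f' y * exp (- (\<alpha> * y\<^sup>2)) * exp (\<alpha> * y\<^sup>2) \<le> (1 + A * y) * exp (\<alpha> * y\<^sup>2)"
    by (rule mult_right_mono) auto
  thus ?thesis
    by (simp add: mult.assoc exp_minus) (simp add: mult.commute)
qed

text \<open>For given \<open>A\<close> and \<open>K\<close> the assumption holds for small \<alpha>,
  and the conclusion places the root beyond \<open>K\<close>. On \<open>[0, K]\<close>,
  \<open>G\<close> starts at \<open>A\<close> and decreases at rate at most \<open>c\<close>, so it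
  is still positive at \<open>K\<close>.\<close>

lemma H_pos:
  assumes "K \<ge> 0" and K: "2 * \<alpha> * K ^ 3 * (1 + A * K) * exp (K\<^sup>2) < A"
  shows "H K > 0"
proof -
  define c where "c = 2 * \<alpha> * K\<^sup>2 * (1 + A * K) * exp (K\<^sup>2)"
  have "G 0 + c * 0 \<le> G K + c * K"
  proof (rule DERIV_nonneg_imp_nondecreasing[OF \<open>K \<ge> 0\<close>, where f = "\<lambda>y. G y + c * y"])
    fix x assume x: "0 \<le> x" "x \<le> K"
    have d: "((\<lambda>y. G y + c * y) has_real_derivative - (2 * \<alpha> * x\<^sup>2 * f' x * exp (x\<^sup>2 / 2)) + c) (at x)"
      by (auto intro!: derivative_eq_intros G_has_derivative)
    have "f' x * exp (x\<^sup>2 / 2) \<le> exp (\<alpha> * x\<^sup>2) * (1 + A * x) * exp (x\<^sup>2 / 2)"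
      using x f'_le[of x] by (intro mult_right_mono) auto
    also have "\<dots> = (1 + A * x) * exp (\<alpha> * x\<^sup>2 + x\<^sup>2 / 2)"
      by (simp add: exp_add mult_ac)
    also have "\<dots> \<le> (1 + A * K) * exp (K\<^sup>2)"
    proof (rule mult_mono)
      have "\<alpha> * x\<^sup>2 \<le> 1/2 * x\<^sup>2"
        using \<alpha> by (intro mult_right_mono) auto
      moreover have "x\<^sup>2 \<le> K\<^sup>2"
        using x by (intro power_mono) auto
      ultimately have "\<alpha> * x\<^sup>2 + x\<^sup>2 / 2 \<le> K\<^sup>2"
        by linarith
      thus "exp (\<alpha> * x\<^sup>2 + x\<^sup>2 / 2) \<le> exp (K\<^sup>2)"
        by simp
    qed (use x A in \<open>auto simp: add_nonneg_nonneg mult_left_mono\<close>)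
    finally have le: "f' x * exp (x\<^sup>2 / 2) \<le> (1 + A * K) * exp (K\<^sup>2)" .
    have "(2 * \<alpha> * x\<^sup>2) * (f' x * exp (x\<^sup>2 / 2)) \<le> (2 * \<alpha> * K\<^sup>2) * ((1 + A * K) * exp (K\<^sup>2))"
      using x A \<alpha> f'_pos[of x] by (intro mult_mono[OF _ le]) (auto intro: power_mono less_imp_le)
    thus "\<exists>d. ((\<lambda>y. G y + c * y) has_real_derivative d) (at x) \<and> 0 \<le> d"
      using d by (intro exI conjI) (auto simp: mult.assoc c_def)
  qed
  moreover have "c * K < A"
    using K by (simp add: c_def power2_eq_square power3_eq_cube mult_ac)
  ultimately have "G K > 0"
    by (simp add: G_0)
  thus ?thesis by (simp add: G_def zero_less_mult_iff)
qed

lemma ex1_root: "\<exists>!b. b > 0 \<and> H b = 0"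
proof -
  \<comment> \<open>The second entry gives \<open>2/3 \<alpha> y \<ge> 2 A\<close>, the first gives
    \<open>y \<le> y ^ 3\<close>; so \<open>G_le\<close> makes \<open>G y\<close> negative.\<close>
  define y where "y = max 1 (3 * A / \<alpha>)"
  have y: "y \<ge> 1" "y \<ge> 3 * A / \<alpha>"
    by (auto simp: y_def)
  have "A < 2 / 3 * \<alpha> * y"
    using y(2) \<alpha> A by (simp add: field_simps)
  also have "\<dots> \<le> 2 / 3 * \<alpha> * y ^ 3"
    using y(1) \<alpha> power_increasing[of 1 3 y] by (intro mult_left_mono) auto
  finally have "G y < 0"
    using G_le[of y] y(1) by linarith
  hence "H y < 0"
    by (simp add: G_def mult_less_0_iff)
  moreover have "continuous_on {0..y} H"
    using H_has_derivative DERIV_isCont by (intro continuous_at_imp_continuous_on) blast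
  ultimately obtain b where b: "0 \<le> b" "b \<le> y" "H b = 0"
    using IVT2'[of H y 0 0] H_0 A y(1) by auto
  have "b \<noteq> 0"
    using b H_0 A by auto
  show ?thesis
  proof (rule ex1I[of _ b])
    show "b > 0 \<and> H b = 0"
      using b \<open>b \<noteq> 0\<close> by simp
  next
    fix c assume "c > 0 \<and> H c = 0"
    thus "c = b"
      using H_strict_antimono[of b c] H_strict_antimono[of c b] b by (cases b c rule: linorder_cases) auto
  qed
qed

text \<open>Integrates \<open>f''_ge\<close>; this is the lower half of the squeeze for
  \<open>f'\<close> at the root.\<close>

lemma f'_ge_integral:
  assumes "y \<ge> 0"
  shows "f' y \<ge> 1 + A * integral {0..y} (\<lambda>s. exp (- s\<^sup>2 / 2))"
proof -
  have int: "(f'' has_integral f' y - f' 0) {0..y}"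
    using assms f'_f''
    by (intro fundamental_theorem_of_calculus)
       (auto simp: has_real_derivative_iff_has_vector_derivative[symmetric] intro: DERIV_subset)
  have "((\<lambda>s. A * exp (- s\<^sup>2 / 2)) has_integral A * integral {0..y} (\<lambda>s. exp (- s\<^sup>2 / 2))) {0..y}"
    by (intro has_integral_mult_right integrable_integral integrable_continuous_real continuous_intros) auto
  from has_integral_le[OF this int] show ?thesis
    using f''_ge by (simp add: f'_0)
qed

context
  fixes b assumes b: "b > 0" "H b = 0"
begin

lemma root_cubed_le: "2 / 3 * \<alpha> * b ^ 3 \<le> A"
  using G_le[of b] b by (simp add: G_def)

text \<open>Integrates \<open>f'_exp_has_derivative\<close> up to the root. There
  \<open>H \<ge> 0\<close>, so the decaying factor in \<alpha> may be dropped, and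
  \<open>G \<le> A\<close> bounds \<open>H s\<close> by
  \<open>A exp (- s\<^sup>2 / 2)\<close>.\<close>

lemma f'_root_le: "f' b \<le> exp (\<alpha> * b\<^sup>2) * (1 + A * integral {0..b} (\<lambda>s. exp (- s\<^sup>2 / 2)))"
proof -
  have int: "((\<lambda>y. H y * exp (- (\<alpha> * y\<^sup>2))) has_integral
      f' b * exp (- (\<alpha> * b\<^sup>2)) - f' 0 * exp (- (\<alpha> * 0\<^sup>2))) {0..b}"
    using b f'_exp_has_derivative
    by (intro fundamental_theorem_of_calculus)
       (auto simp: has_real_derivative_iff_has_vector_derivative[symmetric] intro: DERIV_subset)
  have "((\<lambda>s. A * exp (- s\<^sup>2 / 2)) has_integral A * integral {0..b} (\<lambda>s. exp (- s\<^sup>2 / 2))) {0..b}"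
    by (intro has_integral_mult_right integrable_integral integrable_continuous_real continuous_intros) auto
  note le = has_integral_le[OF int this]
  have "H s * exp (- (\<alpha> * s\<^sup>2)) \<le> A * exp (- s\<^sup>2 / 2)" if "s \<in> {0..b}" for s
  proof -
    have "H s \<ge> 0"
      using H_strict_antimono[of s b] that b by (cases "s = b") auto
    hence "H s * exp (- (\<alpha> * s\<^sup>2)) \<le> H s * 1"
      using \<alpha> by (intro mult_left_mono) auto
    also have "\<dots> = G s * exp (- s\<^sup>2 / 2)"
      by (simp add: G_def exp_minus)
    also have "\<dots> \<le> A * exp (- s\<^sup>2 / 2)"
    proof (rule mult_right_mono)
      have "0 \<le> 2 / 3 * \<alpha> * s ^ 3"
        using \<alpha> that by simp
      thus "G s \<le> A"
        using G_le[of s] that by simp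
    qed simp
    finally show ?thesis .
  qed
  hence "f' b * exp (- (\<alpha> * b\<^sup>2)) \<le> 1 + A * integral {0..b} (\<lambda>s. exp (- s\<^sup>2 / 2))"
    using le by (simp add: f'_0)
  hence "f' b * exp (- (\<alpha> * b\<^sup>2)) * exp (\<alpha> * b\<^sup>2) \<le>
      (1 + A * integral {0..b} (\<lambda>s. exp (- s\<^sup>2 / 2))) * exp (\<alpha> * b\<^sup>2)"
    by (rule mult_right_mono) auto
  thus ?thesis
    by (simp add: mult.assoc exp_minus) (simp add: mult.commute)
qed

end

end

section \<open>Passage to the limit for \<open>B\<close> and \<open>C\<close>\<close>

lemma gaussian_integral_tendsto:
  "((\<lambda>y. integral {0..y} (\<lambda>s. exp (- s\<^sup>2 / 2))) \<longlongrightarrow> sqrt (pi / 2)) at_top"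
proof -
  let ?g = "\<lambda>s::real. exp (- s\<^sup>2 / 2)"
  \<comment> \<open>Substitution \<open>x / sqrt 2\<close> in the half-line integral of
    \<open>exp (- x\<^sup>2)\<close>, whose value is \<open>sqrt pi / 2\<close>.\<close>
  have "has_bochner_integral lborel (\<lambda>x. indicator {0..} (0 + 1 / sqrt 2 * x) *\<^sub>R
      exp (- (0 + 1 / sqrt 2 * x)\<^sup>2)) (sqrt pi / 2 /\<^sub>R \<bar>1 / sqrt 2\<bar>)"
    using gaussian_moment_0 by (subst (asm) lborel_has_bochner_integral_real_affine_iff[of "1 / sqrt 2" _ _ 0]) auto
  moreover have "indicator {0..} (0 + 1 / sqrt 2 * x) *\<^sub>R exp (- (0 + 1 / sqrt 2 * x)\<^sup>2)
      = indicator {0..} x *\<^sub>R ?g x" for x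
    by (auto simp: power_divide zero_le_divide_iff split: split_indicator)
  moreover have "sqrt pi / 2 /\<^sub>R \<bar>1 / sqrt 2\<bar> = sqrt (pi / 2)"
    by (simp add: real_sqrt_divide field_simps)
  ultimately have hb: "has_bochner_integral lborel (\<lambda>x. indicator {0..} x *\<^sub>R ?g x) (sqrt (pi / 2))"
    by (simp only:)
  have "((\<lambda>y. \<integral>x. indicator {..y} x *\<^sub>R (indicator {0..} x *\<^sub>R ?g x) \<partial>lborel)
      \<longlongrightarrow> (\<integral>x. indicator {0..} x *\<^sub>R ?g x \<partial>lborel)) at_top"
    using hb by (intro tendsto_integral_at_top) (auto dest: integrable.intros)
  moreover have "(\<integral>x. indicator {..y} x *\<^sub>R (indicator {0..} x *\<^sub>R ?g x) \<partial>lborel) = integral {0..y} ?g" for y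
  proof -
    have "set_integrable lborel {0..y} ?g"
      by (intro borel_integrable_atLeastAtMost' continuous_intros) auto
    moreover have "(\<integral>x. indicator {..y} x *\<^sub>R (indicator {0..} x *\<^sub>R ?g x) \<partial>lborel) = (LINT x:{0..y}|lborel. ?g x)"
      unfolding set_lebesgue_integral_def
      by (intro Bochner_Integration.integral_cong) (auto split: split_indicator)
    ultimately show ?thesis
      by (simp only: set_borel_integral_eq_integral(2))
  qed
  ultimately show ?thesis
    using hb by (simp add: has_bochner_integral_iff)
qed

lemma F_ode_F:
  assumes "0 < \<alpha>" "\<alpha> < 1/2"
  shows "F_ode \<alpha> (F0 \<alpha>) (\<lambda>y. F y \<alpha>) (\<lambda>y. F' y \<alpha>)"
  using assms F_has_derivative[OF assms(2)] F'_has_derivative[OF assms(2)] F'_0[OF assms(2)] F_0 F0_pos by unfold_locales auto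

text \<open>Positivity of \<open>F'\<close> turns the equation defining \<open>B\<close> into
  \<open>H b = 0\<close>, which has exactly one positive solution. There \<open>F = B F'\<close>, so
  the constant \<open>C\<close> is \<open>1 / F'\<close>.\<close>

lemma
  assumes "0 < \<alpha>" "\<alpha> < 1/2"
  shows B_pos: "B \<alpha> > 0" and B_root: "F (B \<alpha>) \<alpha> - B \<alpha> * F' (B \<alpha>) \<alpha> = 0"
    and C_eq: "C \<alpha> = 1 / F' (B \<alpha>) \<alpha>"
proof -
  interpret F_ode \<alpha> "F0 \<alpha>" "\<lambda>y. F y \<alpha>" "\<lambda>y. F' y \<alpha>"
    by (rule F_ode_F[OF assms])
  have eq: "b > 0 \<and> b = F b \<alpha> / deriv (\<lambda>y. F y \<alpha>) b \<longleftrightarrow> b > 0 \<and> H b = 0" for b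
    using f'_pos[of b] unfolding F'_def[symmetric] H_def by (auto simp: field_simps)
  have "B \<alpha> > 0 \<and> H (B \<alpha>) = 0"
    unfolding B_def eq by (rule theI'[OF ex1_root])
  thus B: "B \<alpha> > 0" "F (B \<alpha>) \<alpha> - B \<alpha> * F' (B \<alpha>) \<alpha> = 0"
    by (auto simp: H_def)
  have "F' (B \<alpha>) \<alpha> > 0"
    using f'_pos[of "B \<alpha>"] B by simp
  thus "C \<alpha> = 1 / F' (B \<alpha>) \<alpha>"
    unfolding C_def using B by (intro the_equality) (auto simp: field_simps)
qed

lemma eventually_small: "\<forall>\<^sub>F \<alpha> in at_right 0. 0 < \<alpha> \<and> \<alpha> < (1/2 :: real)"
  by (auto simp: eventually_at_right_field intro!: exI[of _ "1/2"])

lemma B_at_top: "filterlim B at_top (at_right 0)"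
  unfolding filterlim_at_top_ge[where c = 0]
proof (intro allI impI)
  fix K :: real assume K: "K \<ge> 0"
  \<comment> \<open>The gap in the hypothesis of \<open>H_pos\<close>. Its limit
    \<open>sqrt (2 / pi)\<close> is positive, so \<open>H\<close> is eventually positive at
    \<open>K\<close>, and its root lies beyond \<open>K\<close> by monotonicity.\<close>
  have "((\<lambda>\<alpha>. F0 \<alpha> - 2 * \<alpha> * K ^ 3 * (1 + F0 \<alpha> * K) * exp (K\<^sup>2)) \<longlongrightarrow>
      sqrt (2 / pi) - 2 * 0 * K ^ 3 * (1 + sqrt (2 / pi) * K) * exp (K\<^sup>2)) (at_right 0)"
    by (intro tendsto_intros F0_tendsto)
  hence "\<forall>\<^sub>F \<alpha> in at_right 0. F0 \<alpha> - 2 * \<alpha> * K ^ 3 * (1 + F0 \<alpha> * K) * exp (K\<^sup>2) > 0"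
    by (rule order_tendstoD) auto
  with eventually_small show "\<forall>\<^sub>F \<alpha> in at_right 0. K \<le> B \<alpha>"
  proof eventually_elim
    case (elim \<alpha>)
    then interpret F_ode \<alpha> "F0 \<alpha>" "\<lambda>y. F y \<alpha>" "\<lambda>y. F' y \<alpha>"
      by (intro F_ode_F) auto
    have "H K > 0"
      using elim K by (intro H_pos) auto
    moreover have "H (B \<alpha>) = 0" "B \<alpha> > 0"
      using B_root[of \<alpha>] B_pos[of \<alpha>] elim by (auto simp: H_def)
    ultimately show "K \<le> B \<alpha>"
      using H_strict_antimono[of "B \<alpha>" K] by force
  qed
qed

lemma C_tendsto: "(C \<longlongrightarrow> 1/2) (at_right 0)"
proof -
  \<comment> \<open>\<open>\<Psi>\<close> is the lower bound for \<open>F'\<close> at the root; the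
    upper bound differs from it only by the factor \<open>exp (\<alpha> B\<^sup>2)\<close>.\<close>
  define \<Psi> where "\<Psi> = (\<lambda>\<alpha>. 1 + F0 \<alpha> * integral {0..B \<alpha>} (\<lambda>s. exp (- s\<^sup>2 / 2)))"
  have "(\<Psi> \<longlongrightarrow> 1 + sqrt (2 / pi) * sqrt (pi / 2)) (at_right 0)"
    unfolding \<Psi>_def
    by (intro tendsto_intros F0_tendsto filterlim_compose[OF gaussian_integral_tendsto B_at_top])
  hence \<Psi>: "(\<Psi> \<longlongrightarrow> 2) (at_right 0)"
    by (simp flip: real_sqrt_mult)
  \<comment> \<open>Dividing the bound on \<open>\<alpha> B ^ 3\<close> from
    \<open>root_cubed_le\<close> by \<open>B\<close> leaves \<open>3/2 F0 / B\<close>, which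
    vanishes in the limit because \<open>B\<close> tends to infinity.\<close>
  have "((\<lambda>\<alpha>. \<alpha> * (B \<alpha>)\<^sup>2) \<longlongrightarrow> 0) (at_right 0)"
  proof (rule tendsto_sandwich[OF _ _ tendsto_const])
    have "((\<lambda>\<alpha>. 3 / 2 * F0 \<alpha> * inverse (B \<alpha>)) \<longlongrightarrow> 3 / 2 * sqrt (2 / pi) * 0) (at_right 0)"
      by (intro tendsto_intros F0_tendsto filterlim_compose[OF tendsto_inverse_0_at_top[OF filterlim_ident] B_at_top])
    thus "((\<lambda>\<alpha>. 3 / 2 * F0 \<alpha> * inverse (B \<alpha>)) \<longlongrightarrow> 0) (at_right 0)"
      by simp
    show "\<forall>\<^sub>F \<alpha> in at_right 0. 0 \<le> \<alpha> * (B \<alpha>)\<^sup>2"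
      using eventually_small by eventually_elim auto
    show "\<forall>\<^sub>F \<alpha> in at_right 0. \<alpha> * (B \<alpha>)\<^sup>2 \<le> 3 / 2 * F0 \<alpha> * inverse (B \<alpha>)"
      using eventually_small
    proof eventually_elim
      case (elim \<alpha>)
      then interpret F_ode \<alpha> "F0 \<alpha>" "\<lambda>y. F y \<alpha>" "\<lambda>y. F' y \<alpha>"
        by (intro F_ode_F) auto
      have "H (B \<alpha>) = 0" "B \<alpha> > 0"
        using B_root[of \<alpha>] B_pos[of \<alpha>] elim by (auto simp: H_def)
      with root_cubed_le[of "B \<alpha>"] show ?case
        by (simp add: field_simps power2_eq_square power3_eq_cube)
    qed
  qed
  hence up: "((\<lambda>\<alpha>. exp (\<alpha> * (B \<alpha>)\<^sup>2) * \<Psi> \<alpha>) \<longlongrightarrow> exp 0 * 2) (at_right 0)"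
    by (intro tendsto_intros \<Psi>)
  have "((\<lambda>\<alpha>. F' (B \<alpha>) \<alpha>) \<longlongrightarrow> 2) (at_right 0)"
  proof (rule tendsto_sandwich[OF _ _ \<Psi>])
    show "((\<lambda>\<alpha>. exp (\<alpha> * (B \<alpha>)\<^sup>2) * \<Psi> \<alpha>) \<longlongrightarrow> 2) (at_right 0)"
      using up by simp
    show "\<forall>\<^sub>F \<alpha> in at_right 0. \<Psi> \<alpha> \<le> F' (B \<alpha>) \<alpha>"
      using eventually_small
    proof eventually_elim
      case (elim \<alpha>)
      then interpret F_ode \<alpha> "F0 \<alpha>" "\<lambda>y. F y \<alpha>" "\<lambda>y. F' y \<alpha>"
        by (intro F_ode_F) auto
      show ?case
        unfolding \<Psi>_def using B_pos[of \<alpha>] elim by (intro f'_ge_integral) auto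
    qed
    show "\<forall>\<^sub>F \<alpha> in at_right 0. F' (B \<alpha>) \<alpha> \<le> exp (\<alpha> * (B \<alpha>)\<^sup>2) * \<Psi> \<alpha>"
      using eventually_small
    proof eventually_elim
      case (elim \<alpha>)
      then interpret F_ode \<alpha> "F0 \<alpha>" "\<lambda>y. F y \<alpha>" "\<lambda>y. F' y \<alpha>"
        by (intro F_ode_F) auto
      show ?case
        unfolding \<Psi>_def using B_root[of \<alpha>] B_pos[of \<alpha>] elim by (intro f'_root_le) (auto simp: H_def)
    qed
  qed
  hence "((\<lambda>\<alpha>. 1 / F' (B \<alpha>) \<alpha>) \<longlongrightarrow> 1 / 2) (at_right 0)"
    by (intro tendsto_intros) auto
  moreover have "\<forall>\<^sub>F \<alpha> in at_right 0. 1 / F' (B \<alpha>) \<alpha> = C \<alpha>"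
    using eventually_small by eventually_elim (simp add: C_eq)
  ultimately show ?thesis
    by (rule Lim_transform_eventually)
qed

section \<open>Square-integrable functions\<close>

definition sq_integrable :: "'a measure \<Rightarrow> ('a \<Rightarrow> real) \<Rightarrow> bool" where
  "sq_integrable M f \<longleftrightarrow> f \<in> borel_measurable M \<and> integrable M (\<lambda>x. (f x)\<^sup>2)"

definition L2_norm :: "'a measure \<Rightarrow> ('a \<Rightarrow> real) \<Rightarrow> real" where
  "L2_norm M f = sqrt (\<integral>x. (f x)\<^sup>2 \<partial>M)"

lemma sq_integrable_measurable: "sq_integrable M f \<Longrightarrow> f \<in> borel_measurable M"
  by (simp add: sq_integrable_def)

lemma sq_integrable_mult:
  assumes "sq_integrable M f" "sq_integrable M g"
  shows "integrable M (\<lambda>x. f x * g x)"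
proof (rule Bochner_Integration.integrable_bound)
  show "integrable M (\<lambda>x. (f x)\<^sup>2 + (g x)\<^sup>2)"
    using assms by (auto simp: sq_integrable_def)
  have "\<bar>f x * g x\<bar> \<le> (f x)\<^sup>2 + (g x)\<^sup>2" for x
  proof -
    have "0 \<le> \<bar>f x\<bar> * \<bar>g x\<bar>" "2 * (\<bar>f x\<bar> * \<bar>g x\<bar>) \<le> (f x)\<^sup>2 + (g x)\<^sup>2"
      using sum_squares_bound[of "\<bar>f x\<bar>" "\<bar>g x\<bar>"] by (simp_all add: mult.assoc)
    thus ?thesis
      unfolding abs_mult by linarith
  qed
  thus "AE x in M. norm (f x * g x) \<le> norm ((f x)\<^sup>2 + (g x)\<^sup>2)"
    by auto
qed (use assms in \<open>auto simp: sq_integrable_def\<close>)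

lemma sq_integrable_add:
  assumes "sq_integrable M f" "sq_integrable M g"
  shows "sq_integrable M (\<lambda>x. f x + g x)"
proof -
  have "integrable M (\<lambda>x. (f x)\<^sup>2 + (g x)\<^sup>2 + 2 * (f x * g x))"
    using assms sq_integrable_mult[OF assms] unfolding sq_integrable_def
    by (intro Bochner_Integration.integrable_add integrable_mult_right) auto
  thus ?thesis
    using assms by (auto simp: sq_integrable_def power2_sum mult_ac)
qed

lemma sq_integrable_cmult: "sq_integrable M f \<Longrightarrow> sq_integrable M (\<lambda>x. c * f x)"
  by (auto simp: sq_integrable_def power_mult_distrib)

lemma sq_integrable_diff:
  assumes "sq_integrable M f" "sq_integrable M g"
  shows "sq_integrable M (\<lambda>x. f x - g x)"
  using sq_integrable_add[OF assms(1) sq_integrable_cmult[OF assms(2), of "-1"]] by simp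

lemma sq_integrable_bound:
  assumes "sq_integrable M g" "f \<in> borel_measurable M" "AE x in M. \<bar>f x\<bar> \<le> \<bar>g x\<bar>"
  shows "sq_integrable M f"
proof -
  have "integrable M (\<lambda>x. (f x)\<^sup>2)"
    by (rule Bochner_Integration.integrable_bound[of _ "\<lambda>x. (g x)\<^sup>2"])
       (use assms in \<open>auto simp: sq_integrable_def abs_le_square_iff\<close>)
  thus ?thesis using assms by (auto simp: sq_integrable_def)
qed

lemma L2_norm_nonneg [simp]: "L2_norm M f \<ge> 0"
  by (simp add: L2_norm_def)

lemma L2_norm_square: "(L2_norm M f)\<^sup>2 = (\<integral>x. (f x)\<^sup>2 \<partial>M)"
  by (simp add: L2_norm_def)

lemma L2_norm_mono:
  assumes "sq_integrable M g" "f \<in> borel_measurable M" "AE x in M. \<bar>f x\<bar> \<le> \<bar>g x\<bar>"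
  shows "L2_norm M f \<le> L2_norm M g"
  unfolding L2_norm_def using sq_integrable_bound[OF assms] assms
  by (intro real_sqrt_le_mono integral_mono_AE) (auto simp: sq_integrable_def abs_le_square_iff)

lemma L2_norm_cmult: "L2_norm M (\<lambda>x. c * f x) = \<bar>c\<bar> * L2_norm M f"
  by (simp add: L2_norm_def power_mult_distrib real_sqrt_mult)

text \<open>The integral of \<open>(f + t g)\<^sup>2\<close> is a nonnegative polynomial in
  \<open>t\<close> of degree at most two, so its discriminant is not positive.\<close>

lemma L2_Cauchy_Schwarz:
  assumes "sq_integrable M f" "sq_integrable M g"
  shows "\<bar>\<integral>x. f x * g x \<partial>M\<bar> \<le> L2_norm M f * L2_norm M g"
proof -
  define a where "a = (\<integral>x. (f x)\<^sup>2 \<partial>M)"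
  define b where "b = (\<integral>x. (g x)\<^sup>2 \<partial>M)"
  define c where "c = (\<integral>x. f x * g x \<partial>M)"
  have ab: "a \<ge> 0" "b \<ge> 0"
    by (auto simp: a_def b_def)
  have *: "0 \<le> a + 2 * t * c + t\<^sup>2 * b" for t
  proof -
    have "0 \<le> (\<integral>x. (f x + t * g x)\<^sup>2 \<partial>M)"
      by simp
    also have "\<dots> = (\<integral>x. (f x)\<^sup>2 + 2 * t * (f x * g x) + t\<^sup>2 * (g x)\<^sup>2 \<partial>M)"
      by (simp add: power2_sum power_mult_distrib mult_ac add_ac)
    also have "\<dots> = a + 2 * t * c + t\<^sup>2 * b"
      using assms sq_integrable_mult[OF assms]
      by (simp add: sq_integrable_def a_def b_def c_def)
    finally show ?thesis .
  qed
  have "c\<^sup>2 \<le> a * b"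
  proof (cases "b = 0")
    case True
    show ?thesis
    proof (cases "c = 0")
      case False
      \<comment> \<open>If \<open>g\<close> has norm zero, the polynomial is affine, and this
        \<open>t\<close> would make it equal to -1.\<close>
      hence "2 * (- (a + 1) / (2 * c)) * c = - (a + 1)"
        by simp
      with *[of "- (a + 1) / (2 * c)"] True show ?thesis
        by simp
    qed (use ab in auto)
  next
    case False
    hence "b > 0" using ab by simp
    with *[of "- c / b"] have "0 \<le> a - c\<^sup>2 / b"
      by (simp add: power2_eq_square field_simps)
    thus ?thesis
      using \<open>b > 0\<close> by (simp add: field_simps)
  qed
  hence "sqrt (c\<^sup>2) \<le> sqrt (a * b)"
    by (rule real_sqrt_le_mono)
  thus ?thesis
    by (simp add: L2_norm_def a_def b_def c_def real_sqrt_mult)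
qed

lemma L2_norm_triangle:
  assumes "sq_integrable M f" "sq_integrable M g"
  shows "L2_norm M (\<lambda>x. f x + g x) \<le> L2_norm M f + L2_norm M g"
proof (rule power2_le_imp_le)
  have "(L2_norm M (\<lambda>x. f x + g x))\<^sup>2 = (\<integral>x. (f x)\<^sup>2 + 2 * (f x * g x) + (g x)\<^sup>2 \<partial>M)"
    unfolding L2_norm_square by (simp add: power2_sum mult_ac add_ac)
  also have "\<dots> = (L2_norm M f)\<^sup>2 + 2 * (\<integral>x. f x * g x \<partial>M) + (L2_norm M g)\<^sup>2"
    using assms sq_integrable_mult[OF assms]
    by (simp add: sq_integrable_def L2_norm_square)
  also have "\<dots> \<le> (L2_norm M f + L2_norm M g)\<^sup>2"
    using L2_Cauchy_Schwarz[OF assms] by (simp add: power2_sum)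
  finally show "(L2_norm M (\<lambda>x. f x + g x))\<^sup>2 \<le> (L2_norm M f + L2_norm M g)\<^sup>2" .
qed simp

lemma L2_norm_minus: "L2_norm M (\<lambda>x. f x - g x) = L2_norm M (\<lambda>x. g x - f x)"
  by (simp add: L2_norm_def power2_commute)

lemma L2_norm_triangle_diff:
  assumes "sq_integrable M f" "sq_integrable M g"
  shows "\<bar>L2_norm M f - L2_norm M g\<bar> \<le> L2_norm M (\<lambda>x. f x - g x)"
  using L2_norm_triangle[OF assms(1) sq_integrable_diff[OF assms(2,1)]]
    L2_norm_triangle[OF assms(2) sq_integrable_diff[OF assms]]
    L2_norm_minus[of M f g] by simp

section \<open>Square-integrable and normal random variables on a probability space\<close>

context prob_space
begin

lemma sq_integrable_const: "sq_integrable M (\<lambda>_. c)"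
  by (simp add: sq_integrable_def)

lemma sq_integrable_imp_integrable: "sq_integrable M f \<Longrightarrow> integrable M f"
  using sq_integrable_mult[of M f "\<lambda>_. 1"] sq_integrable_const[of 1] by simp

lemma expectation_abs_le_L2_norm:
  assumes "sq_integrable M f"
  shows "expectation (\<lambda>x. \<bar>f x\<bar>) \<le> L2_norm M f"
proof -
  have "sq_integrable M (\<lambda>x. \<bar>f x\<bar>)"
    using assms by (auto simp: sq_integrable_def)
  from L2_Cauchy_Schwarz[OF this sq_integrable_const[of 1]] show ?thesis
    by (simp add: L2_norm_def prob_space)
qed

text \<open>Transfers \<open>L\<^sup>2\<close>-closeness to expectations after a contraction, such
  as taking the positive part or multiplying by an indicator; \<open>h\<close> is then the
  difference of the two arguments.\<close>

lemma expectation_diff_le_L2_norm: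
  assumes "integrable M f" "integrable M g" "sq_integrable M h"
    and "\<And>x. x \<in> space M \<Longrightarrow> \<bar>f x - g x\<bar> \<le> \<bar>h x\<bar>"
  shows "\<bar>expectation f - expectation g\<bar> \<le> L2_norm M h"
proof -
  have "\<bar>expectation f - expectation g\<bar> = \<bar>expectation (\<lambda>x. f x - g x)\<bar>"
    using assms by simp
  also have "\<dots> \<le> expectation (\<lambda>x. \<bar>f x - g x\<bar>)"
    by (rule integral_abs_bound)
  also have "\<dots> \<le> expectation (\<lambda>x. \<bar>h x\<bar>)"
    using assms sq_integrable_imp_integrable by (intro integral_mono) auto
  also have "\<dots> \<le> L2_norm M h"
    by (rule expectation_abs_le_L2_norm) fact
  finally show ?thesis .
qed

lemma
  assumes Z: "distributed M lborel Z (normal_density 0 \<sigma>)" and \<sigma>: "\<sigma> > 0"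
  shows normal_sq_integrable: "sq_integrable M Z"
    and normal_expectation_0: "expectation Z = 0"
    and normal_L2_norm: "L2_norm M Z = \<sigma>"
    and normal_expectation_pos_part: "expectation (\<lambda>x. max 0 (Z x)) = \<sigma> / sqrt (2 * pi)"
proof -
  have meas: "Z \<in> borel_measurable M"
    using distributed_measurable[OF Z] by simp
  have int: "integrable M (\<lambda>x. g (Z x))" "expectation (\<lambda>x. g (Z x)) = e"
    if "has_bochner_integral lborel (\<lambda>x. normal_density 0 \<sigma> x * g x) e" "g \<in> borel_measurable borel" for g e
    using distributed_integrable[OF Z, of g] distributed_integral[OF Z, of g] that
    by (auto simp: has_bochner_integral_iff)
  show "expectation Z = 0"
    using int(2)[OF normal_moment_odd[OF \<sigma>, of 0 0, simplified]] by simp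
  have sq: "integrable M (\<lambda>x. (Z x)\<^sup>2)" "expectation (\<lambda>x. (Z x)\<^sup>2) = \<sigma>\<^sup>2"
    using int[of "\<lambda>x. x\<^sup>2" "\<sigma>\<^sup>2"] normal_moment_even[OF \<sigma>, of 0 1]
    by (simp_all add: fact_numeral)
  show sqi: "sq_integrable M Z"
    using sq meas by (simp add: sq_integrable_def)
  show "L2_norm M Z = \<sigma>"
    using sq \<sigma> by (simp add: L2_norm_def)
  have abs: "integrable M (\<lambda>x. \<bar>Z x\<bar>)" "expectation (\<lambda>x. \<bar>Z x\<bar>) = \<sigma> * sqrt (2 / pi)"
    using int[of "\<lambda>x. \<bar>x\<bar>" "\<sigma> * sqrt (2 / pi)"] normal_moment_abs_odd[OF \<sigma>, of 0 0]
    by simp_all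
  have "max 0 (Z x) = 1/2 * (\<bar>Z x\<bar> + Z x)" for x
    by simp
  hence "expectation (\<lambda>x. max 0 (Z x)) = expectation (\<lambda>x. 1/2 * (\<bar>Z x\<bar> + Z x))"
    by (simp only:)
  also have "\<dots> = 1/2 * (expectation (\<lambda>x. \<bar>Z x\<bar>) + expectation Z)"
    using abs sq_integrable_imp_integrable[OF sqi] by simp
  also have "\<dots> = \<sigma> / sqrt (2 * pi)"
    unfolding abs \<open>expectation Z = 0\<close> by (simp add: real_sqrt_divide real_sqrt_mult field_simps)
  finally show "expectation (\<lambda>x. max 0 (Z x)) = \<sigma> / sqrt (2 * pi)" .
qed

end

section \<open>Brownian motion and the Wiener integral of step functions\<close>

text \<open>Finite linear combinations \<open>L\<close> of values of \<open>W\<close>, paired with the step function \<open>h\<close> of which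
  \<open>L\<close> is the Wiener integral. Working with the pairs makes the isometry bilinear and avoids common
  refinements of partitions.\<close>

inductive wiener_pair ::
  "(real \<Rightarrow> 'a \<Rightarrow> real) \<Rightarrow> real \<Rightarrow> (real \<Rightarrow> real) \<Rightarrow> ('a \<Rightarrow> real) \<Rightarrow> bool" for W t where
  base: "0 \<le> b \<Longrightarrow> b \<le> t \<Longrightarrow> wiener_pair W t (indicator {0<..b}) (W b)"
| zero: "wiener_pair W t (\<lambda>_. 0) (\<lambda>_. 0)"
| add: "wiener_pair W t h L \<Longrightarrow> wiener_pair W t h' L' \<Longrightarrow>
    wiener_pair W t (\<lambda>s. h s + h' s) (\<lambda>\<omega>. L \<omega> + L' \<omega>)"
| cmult: "wiener_pair W t h L \<Longrightarrow> wiener_pair W t (\<lambda>s. c * h s) (\<lambda>\<omega>. c * L \<omega>)"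

lemma wiener_pair_mono:
  assumes "wiener_pair W s h L" "s \<le> t"
  shows "wiener_pair W t h L"
  using assms by (induction rule: wiener_pair.induct) (auto intro: wiener_pair.intros)

lemma wiener_pair_diff:
  assumes "wiener_pair W t h L" "wiener_pair W t h' L'"
  shows "wiener_pair W t (\<lambda>s. h s - h' s) (\<lambda>\<omega>. L \<omega> - L' \<omega>)"
  using wiener_pair.add[OF assms(1) wiener_pair.cmult[OF assms(2), of "-1"]] by simp

lemma wiener_pair_sum:
  fixes n :: nat
  assumes "\<And>i. i < n \<Longrightarrow> wiener_pair W t (h i) (L i)"
  shows "wiener_pair W t (\<lambda>s. \<Sum>i<n. h i s) (\<lambda>\<omega>. \<Sum>i<n. L i \<omega>)"
  using assms by (induction n) (auto intro: wiener_pair.intros)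

text \<open>Every increment over a partition interval is the difference of two basic pairs, so the
  step integrals in \<open>has_wiener_integral\<close> are covered.\<close>

lemma wiener_pair_step:
  assumes p: "mono_on {..n} p" "p ` {..n} \<subseteq> {0..t}"
  shows "wiener_pair W t (step_fun n p c) (step_integral W n p c)"
proof -
  have "wiener_pair W t (\<lambda>s. c i * indicator {p i<..p (Suc i)} s) (\<lambda>\<omega>. c i * (W (p (Suc i)) \<omega> - W (p i) \<omega>))"
    if "i < n" for i
  proof (rule wiener_pair.cmult)
    have *: "p i \<in> {0..t}" "p (Suc i) \<in> {0..t}" "p i \<le> p (Suc i)"
      using that p(2) monotone_onD[OF p(1), of i "Suc i"] by (auto simp: image_subset_iff)
    hence "wiener_pair W t (\<lambda>s. indicator {0<..p (Suc i)} s - indicator {0<..p i} s)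
        (\<lambda>\<omega>. W (p (Suc i)) \<omega> - W (p i) \<omega>)"
      by (intro wiener_pair_diff wiener_pair.base) auto
    also have "(\<lambda>s. indicator {0<..p (Suc i)} s - indicator {0<..p i} s) = (indicator {p i<..p (Suc i)} :: real \<Rightarrow> real)"
      using * by (auto simp: fun_eq_iff split: split_indicator)
    finally show "wiener_pair W t (indicator {p i<..p (Suc i)}) (\<lambda>\<omega>. W (p (Suc i)) \<omega> - W (p i) \<omega>)" .
  qed
  hence "wiener_pair W t (\<lambda>s. \<Sum>i<n. c i * indicator {p i<..p (Suc i)} s)
      (\<lambda>\<omega>. \<Sum>i<n. c i * (W (p (Suc i)) \<omega> - W (p i) \<omega>))"
    by (rule wiener_pair_sum)
  thus ?thesis
    unfolding step_fun_def[abs_def] step_integral_def[abs_def] .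
qed

lemma wiener_pair_supp:
  assumes "wiener_pair W t h L" "s \<notin> {0<..t}"
  shows "h s = 0"
  using assms by (induction rule: wiener_pair.induct) auto

lemma sq_integrable_indicator: "sq_integrable lborel (indicator {a<..b :: real})"
proof -
  have "integrable lborel (\<lambda>x. indicator {a<..b} x :: real)"
    using emeasure_lborel_Ioc[of a b] by (cases "a \<le> b") (auto simp: integrable_indicator_iff)
  moreover have "(indicator {a<..b} x :: real)\<^sup>2 = indicator {a<..b} x" for x
    by (simp split: split_indicator)
  ultimately show ?thesis
    by (simp add: sq_integrable_def)
qed

section \<open>Second moments of Brownian motion and the isometry for step integrands\<close>

locale brownian = prob_space M for M :: "'a measure" +
  fixes W :: "real \<Rightarrow> 'a \<Rightarrow> real"
  assumes bm: "brownian_motion M W"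
begin

abbreviation \<F> where "\<F> \<equiv> natural_filtration M W"

lemma W_measurable [measurable]: "t \<in> {0..1} \<Longrightarrow> W t \<in> borel_measurable M"
  using bm by (auto simp: brownian_motion_def)

lemma W_0: "AE \<omega> in M. W 0 \<omega> = 0"
  using bm by (auto simp: brownian_motion_def)

lemma W_indep:
  "mono_on {..n} p \<Longrightarrow> p ` {..n} \<subseteq> {0..1} \<Longrightarrow>
    indep_vars (\<lambda>_. borel) (\<lambda>i \<omega>. W (p (Suc i)) \<omega> - W (p i) \<omega>) {..<n::nat}"
  using bm by (auto simp: brownian_motion_def)

lemma W_normal:
  "0 \<le> s \<Longrightarrow> s < t \<Longrightarrow> t \<le> 1 \<Longrightarrow>
    distributed M lborel (\<lambda>\<omega>. W t \<omega> - W s \<omega>) (normal_density 0 (sqrt (t - s)))"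
  using bm unfolding brownian_motion_def by blast

lemma
  assumes "0 \<le> s" "s \<le> t" "t \<le> 1"
  shows increment_sq_integrable: "sq_integrable M (\<lambda>\<omega>. W t \<omega> - W s \<omega>)"
    and increment_expectation: "expectation (\<lambda>\<omega>. W t \<omega> - W s \<omega>) = 0"
    and increment_square: "expectation (\<lambda>\<omega>. (W t \<omega> - W s \<omega>)\<^sup>2) = t - s"
proof -
  have "sq_integrable M (\<lambda>\<omega>. W t \<omega> - W s \<omega>) \<and> expectation (\<lambda>\<omega>. W t \<omega> - W s \<omega>) = 0
    \<and> expectation (\<lambda>\<omega>. (W t \<omega> - W s \<omega>)\<^sup>2) = t - s"
  proof (cases "s = t")
    case True
    thus ?thesis using sq_integrable_const[of 0] by simp
  next
    case False
    hence "s < t" using assms by simp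
    hence \<sigma>: "sqrt (t - s) > 0" by simp
    note normal = W_normal[OF assms(1) \<open>s < t\<close> assms(3)]
    show ?thesis
      using normal_sq_integrable[OF normal \<sigma>] normal_expectation_0[OF normal \<sigma>]
        normal_L2_norm[OF normal \<sigma>] L2_norm_square[of M "\<lambda>\<omega>. W t \<omega> - W s \<omega>"] \<open>s < t\<close>
      by simp
  qed
  thus "sq_integrable M (\<lambda>\<omega>. W t \<omega> - W s \<omega>)" "expectation (\<lambda>\<omega>. W t \<omega> - W s \<omega>) = 0"
    "expectation (\<lambda>\<omega>. (W t \<omega> - W s \<omega>)\<^sup>2) = t - s" by auto
qed

lemma W_sq_integrable:
  assumes "t \<in> {0..1}"
  shows "sq_integrable M (W t)"
proof (rule sq_integrable_bound)
  show "sq_integrable M (\<lambda>\<omega>. W t \<omega> - W 0 \<omega>)"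
    using assms by (intro increment_sq_integrable) auto
  show "AE \<omega> in M. \<bar>W t \<omega>\<bar> \<le> \<bar>W t \<omega> - W 0 \<omega>\<bar>"
    using W_0 by eventually_elim simp
qed (use assms in simp)

lemma W_square:
  assumes "t \<in> {0..1}"
  shows "expectation (\<lambda>\<omega>. (W t \<omega>)\<^sup>2) = t"
proof -
  have "expectation (\<lambda>\<omega>. (W t \<omega>)\<^sup>2) = expectation (\<lambda>\<omega>. (W t \<omega> - W 0 \<omega>)\<^sup>2)"
    using W_0 assms by (intro integral_cong_AE) auto
  thus ?thesis
    using increment_square[of 0 t] assms by simp
qed

lemma W_covariance:
  assumes "s \<in> {0..1}" "t \<in> {0..1}"
  shows "expectation (\<lambda>\<omega>. W s \<omega> * W t \<omega>) = min s t"
proof -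
  have *: "expectation (\<lambda>\<omega>. W s \<omega> * W t \<omega>) = s" if "0 \<le> s" "s \<le> t" "t \<le> 1" for s t
  proof -
    have sq: "sq_integrable M (W s)" "sq_integrable M (W t)" "sq_integrable M (\<lambda>\<omega>. W t \<omega> - W s \<omega>)"
      using that by (auto intro!: W_sq_integrable sq_integrable_diff)
    \<comment> \<open>Polarisation expresses the covariance through the second moments of
      \<open>W s\<close>, \<open>W t\<close> and their difference.\<close>
    have "W s \<omega> * W t \<omega> = 1/2 * ((W s \<omega>)\<^sup>2 + (W t \<omega>)\<^sup>2 - (W t \<omega> - W s \<omega>)\<^sup>2)" for \<omega>
      by (simp add: power2_eq_square algebra_simps)
    hence "expectation (\<lambda>\<omega>. W s \<omega> * W t \<omega>) =
        expectation (\<lambda>\<omega>. 1/2 * ((W s \<omega>)\<^sup>2 + (W t \<omega>)\<^sup>2 - (W t \<omega> - W s \<omega>)\<^sup>2))"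
      by (simp only:)
    also have "\<dots> = 1/2 * (s + t - (t - s))"
      using that sq by (simp add: sq_integrable_def W_square increment_square)
    finally show ?thesis by simp
  qed
  show ?thesis
    using *[of s t] *[of t s] assms by (cases s t rule: le_cases) (auto simp: min_def mult.commute)
qed

lemma wiener_pair_sq_integrable:
  assumes "wiener_pair W t h L" "t \<le> 1"
  shows "sq_integrable lborel h" "sq_integrable M L"
proof -
  have "sq_integrable lborel h \<and> sq_integrable M L"
    using assms
  proof (induction rule: wiener_pair.induct)
    case (base b)
    thus ?case by (auto intro!: W_sq_integrable sq_integrable_indicator)
  next
    case zero
    thus ?case by (auto simp: sq_integrable_def)
  qed (auto intro: sq_integrable_add sq_integrable_cmult)
  thus "sq_integrable lborel h" "sq_integrable M L" by auto
qed

text \<open>Both sides are bilinear, so the induction runs over the first pair and, at its basic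
  pairs, over the second. It ends at the covariance \<open>min b c\<close>, which is also the length
  of the intersection of the two intervals.\<close>

lemma wiener_pair_inner:
  assumes "wiener_pair W t h L" "wiener_pair W t h' L'" "t \<le> 1"
  shows "expectation (\<lambda>\<omega>. L \<omega> * L' \<omega>) = (\<integral>s. h s * h' s \<partial>lborel)"
  using assms
proof (induction arbitrary: h' L' rule: wiener_pair.induct)
  case (base b)
  from base(3,1,2,4) show ?case
  proof (induction rule: wiener_pair.induct)
    case (base c)
    have "indicator {0<..b} s * indicator {0<..c} s = (indicator {0<..min b c} s :: real)" for s
      by (auto split: split_indicator)
    moreover have "(\<integral>s. indicator {0<..min b c} s \<partial>lborel) = min b c"
      using base by simp
    ultimately show ?case
      using W_covariance[of b c] base by simp
  next
    case (add h L h' L')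
    thus ?case
      using wiener_pair_sq_integrable[OF add.hyps(1)] wiener_pair_sq_integrable[OF add.hyps(2)]
        W_sq_integrable[of b] sq_integrable_indicator[of 0 b]
      by (simp add: ring_distribs sq_integrable_mult)
  qed (simp_all add: mult.left_commute)
next
  case (add h L h1 L1)
  thus ?case
    using wiener_pair_sq_integrable[OF add.hyps(1)] wiener_pair_sq_integrable[OF add.hyps(2)]
      wiener_pair_sq_integrable[OF add.prems(1)]
    by (simp add: ring_distribs sq_integrable_mult)
qed (simp_all add: mult.assoc)

lemma wiener_pair_isometry:
  assumes "wiener_pair W t h L" "t \<le> 1"
  shows "L2_norm M L = L2_norm lborel h"
  using wiener_pair_inner[OF assms(1,1,2)] by (simp add: L2_norm_def power2_eq_square)

text \<open>Over one ordered partition the increments are independent, so the step integral is a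
  centred normal variable, or identically 0.\<close>

lemma step_integral_pos_part:
  assumes p: "mono_on {..n} p" "p ` {..n} \<subseteq> {0..1}"
  shows "expectation (\<lambda>\<omega>. max 0 (step_integral W n p c \<omega>)) = L2_norm M (step_integral W n p c) / sqrt (2 * pi)"
proof -
  define D where "D = (\<lambda>i \<omega>. W (p (Suc i)) \<omega> - W (p i) \<omega>)"
  \<comment> \<open>Summing independent normal variables requires positive standard deviations and a
    nonempty index set, so the vanishing summands are removed and the empty case is split
    off.\<close>
  define I where "I = {i. i < n \<and> c i \<noteq> 0 \<and> p i < p (Suc i)}"
  have I: "I \<subseteq> {..<n}" "finite I"
    by (auto simp: I_def)
  have mono: "p i \<le> p (Suc i)" if "i < n" for i
    using that monotone_onD[OF p(1), of i "Suc i"] by auto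
  have eq: "step_integral W n p c \<omega> = (\<Sum>i\<in>I. c i * D i \<omega>)" for \<omega>
    unfolding step_integral_def D_def
    by (rule sum.mono_neutral_right) (use I mono in \<open>force simp: I_def less_le\<close>)+
  show ?thesis
  proof (cases "I = {}")
    case True
    thus ?thesis by (simp add: eq L2_norm_def)
  next
    case False
    define \<sigma> where "\<sigma> = (\<lambda>i. \<bar>c i\<bar> * sqrt (p (Suc i) - p i))"
    have \<sigma>: "\<sigma> i > 0" if "i \<in> I" for i
      using that by (auto simp: \<sigma>_def I_def)
    have "distributed M lborel (\<lambda>\<omega>. \<Sum>i\<in>I. c i * D i \<omega>) (normal_density (\<Sum>i\<in>I. 0) (sqrt (\<Sum>i\<in>I. (\<sigma> i)\<^sup>2)))"
    proof (rule sum_indep_normal)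
      have "indep_vars (\<lambda>_. borel) D I"
        unfolding D_def by (rule indep_vars_subset[OF W_indep[OF p] I(1)])
      thus "indep_vars (\<lambda>_. borel) (\<lambda>i \<omega>. c i * D i \<omega>) I"
        by (rule indep_vars_compose2) auto
      fix i assume i: "i \<in> I"
      hence "p i \<in> {0..1}" "p (Suc i) \<in> {0..1}"
        using p(2) I(1) by (auto simp: image_subset_iff)
      hence "distributed M lborel (D i) (normal_density 0 (sqrt (p (Suc i) - p i)))"
        unfolding D_def using i by (intro W_normal) (auto simp: I_def)
      from normal_density_affine[OF this, of "c i" 0] i
      show "distributed M lborel (\<lambda>\<omega>. c i * D i \<omega>) (normal_density 0 (\<sigma> i))"
        by (auto simp: I_def \<sigma>_def)
    qed (use False I \<sigma> in blast)+
    moreover have "(\<Sum>i\<in>I. (\<sigma> i)\<^sup>2) > 0"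
      using \<sigma> False I by (intro sum_pos zero_less_power) auto
    ultimately show ?thesis
      unfolding eq by (simp add: normal_expectation_pos_part normal_L2_norm)
  qed
qed

end

section \<open>Orthogonality to the past\<close>

context brownian
begin

lemma space_natural_filtration [simp]: "space (\<F> t) = space M"
  by (auto simp: natural_filtration_def space_measure_of_conv)

lemma sets_natural_filtration:
  "sets (\<F> t) = sigma_sets (space M) {W s -` A \<inter> space M | s A. s \<in> {0..1} \<and> s \<le> t \<and> A \<in> sets borel}"
  unfolding natural_filtration_def by (rule sets_measure_of) auto

lemma sets_natural_filtration_subset: "sets (\<F> t) \<subseteq> sets M"
  unfolding sets_natural_filtration
  by (rule sets.sigma_sets_subset) (auto intro: measurable_sets)

lemma W_adapted:
  assumes "s \<in> {0..1}" "s \<le> t"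
  shows "W s \<in> borel_measurable (\<F> t)"
proof (rule measurableI)
  fix A :: "real set" assume "A \<in> sets borel"
  thus "W s -` A \<inter> space (\<F> t) \<in> sets (\<F> t)"
    using assms unfolding sets_natural_filtration by (intro sigma_sets.Basic) auto
qed auto

lemma wiener_pair_adapted:
  assumes "wiener_pair W t h L" "t \<le> 1"
  shows "L \<in> borel_measurable (\<F> t)"
  using assms
proof (induction rule: wiener_pair.induct)
  case (base b)
  thus ?case by (intro W_adapted) auto
qed auto

text \<open>The cylinder event is, almost surely, determined by finitely many increments before
  \<open>s\<close>. These are independent of \<open>W b - W s\<close>, which has mean zero.\<close>

lemma increment_orthogonal_cylinder:
  assumes s: "0 \<le> s" "s \<le> b" "b \<le> 1"
    and R: "finite R" "R \<subseteq> {0..s}" and S: "\<And>r. S r \<in> sets borel"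
  shows "(LINT \<omega>:{\<omega> \<in> space M. \<forall>r\<in>R. W r \<omega> \<in> S r}|M. W b \<omega> - W s \<omega>) = 0"
proof -
  \<comment> \<open>Adding 0 lets every \<open>W r\<close> telescope from \<open>W 0\<close>; adding
    \<open>s\<close> makes the last interval of the partition, with index \<open>m\<close>, run
    exactly from \<open>s\<close> to \<open>b\<close>.\<close>
  define T where "T = insert 0 (insert s R)"
  define xs where "xs = sorted_list_of_set T"
  define m where "m = length xs - 1"
  define p where "p = (\<lambda>i. (xs @ [b]) ! i)"
  have T: "finite T" "T \<subseteq> {0..s}" "0 \<in> T" "s \<in> T"
    using R s by (auto simp: T_def)
  have xs: "sorted xs" "set xs = T"
    using T by (auto simp: xs_def)
  have len: "length xs = Suc m"
    using xs T by (cases xs) (auto simp: m_def)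
  have sorted: "sorted (xs @ [b])"
    using xs T s by (auto simp: sorted_append)
  have mono: "mono_on {..Suc m} p"
    unfolding p_def by (intro mono_onI sorted_nth_mono[OF sorted]) (auto simp: len)
  have range: "p ` {..Suc m} \<subseteq> {0..1}"
  proof -
    have "p i \<in> set (xs @ [b])" if "i \<le> Suc m" for i
      unfolding p_def using that by (intro nth_mem) (simp add: len)
    moreover have "set (xs @ [b]) \<subseteq> {0..1}"
      using xs T s by auto
    ultimately show ?thesis by blast
  qed
  have p_Suc_m: "p (Suc m) = b"
    by (simp add: p_def len nth_append)
  have ex: "\<exists>i\<le>m. p i = r" if "r \<in> T" for r
    using that unfolding xs(2)[symmetric] in_set_conv_nth len p_def
    by (auto simp: nth_append len less_Suc_eq_le)
  have p_m: "p m = s"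
  proof -
    obtain i where i: "i \<le> m" "p i = s"
      using ex T by blast
    have "p i \<le> p m"
      using i by (intro mono_onD[OF mono]) auto
    moreover have "p m \<in> T"
      unfolding xs(2)[symmetric] p_def by (simp add: nth_append len)
    ultimately show ?thesis
      using T i by auto
  qed
  have p_0: "p 0 = 0"
  proof -
    obtain i where i: "i \<le> m" "p i = 0"
      using ex T by blast
    have "p 0 \<le> p i"
      using i by (intro mono_onD[OF mono]) auto
    thus ?thesis
      using range i by force
  qed
  obtain idx where idx: "\<And>r. r \<in> T \<Longrightarrow> idx r \<le> m" "\<And>r. r \<in> T \<Longrightarrow> p (idx r) = r"
    using ex by metis
  define D where "D = (\<lambda>i \<omega>. W (p (Suc i)) \<omega> - W (p i) \<omega>)"
  \<comment> \<open>\<open>g\<close> reads the event off the increments: \<open>W r\<close> is the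
    sum of the first \<open>idx r\<close> of them where \<open>W 0 = 0\<close>, hence only almost
    surely.\<close>
  define g where "g = (\<lambda>v :: nat \<Rightarrow> real. \<Prod>r\<in>R. indicator (S r) (\<Sum>i<idx r. v i) :: real)"
  have ind: "indep_vars (\<lambda>_. borel) D {..<Suc m}"
    unfolding D_def using mono range by (rule W_indep)
  have g_meas: "g \<in> borel_measurable (PiM {..<m} (\<lambda>_. borel))"
    unfolding g_def
  proof (intro borel_measurable_prod)
    fix r assume "r \<in> R"
    hence "idx r \<le> m" using idx(1)[of r] by (auto simp: T_def)
    hence "(\<lambda>v. \<Sum>i<idx r. v i :: real) \<in> borel_measurable (PiM {..<m} (\<lambda>_. borel))"
      by (intro borel_measurable_sum measurable_component_singleton) auto
    from measurable_compose[OF this borel_measurable_indicator[OF S]]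
    show "(\<lambda>v. indicator (S r) (\<Sum>i<idx r. v i) :: real) \<in> borel_measurable (PiM {..<m} (\<lambda>_. borel))" .
  qed
  \<comment> \<open>Functions of the disjoint index blocks \<open>{..<m}\<close> and
    \<open>{m}\<close> are independent.\<close>
  have "indep_var borel (g \<circ> (\<lambda>\<omega>. restrict (\<lambda>i. D i \<omega>) {..<m}))
      borel ((\<lambda>v. v m) \<circ> (\<lambda>\<omega>. restrict (\<lambda>i. D i \<omega>) {m}))"
    by (rule indep_var_compose[OF indep_var_restrict[OF ind] g_meas measurable_component_singleton]) auto
  also have "g \<circ> (\<lambda>\<omega>. restrict (\<lambda>i. D i \<omega>) {..<m}) = (\<lambda>\<omega>. g (\<lambda>i. D i \<omega>))"
  proof
    fix \<omega>
    have "(\<Sum>i<idx r. restrict (\<lambda>i. D i \<omega>) {..<m} i) = (\<Sum>i<idx r. D i \<omega>)" if "r \<in> R" for r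
      using idx(1)[of r] that by (intro sum.cong) (auto simp: T_def)
    thus "(g \<circ> (\<lambda>\<omega>. restrict (\<lambda>i. D i \<omega>) {..<m})) \<omega> = g (\<lambda>i. D i \<omega>)"
      by (simp add: g_def)
  qed
  also have "(\<lambda>v. v m) \<circ> (\<lambda>\<omega>. restrict (\<lambda>i. D i \<omega>) {m}) = (\<lambda>\<omega>. W b \<omega> - W s \<omega>)"
    by (auto simp: D_def p_m p_Suc_m)
  finally have indep: "indep_var borel (\<lambda>\<omega>. g (\<lambda>i. D i \<omega>)) borel (\<lambda>\<omega>. W b \<omega> - W s \<omega>)" .
  have g_meas': "(\<lambda>\<omega>. g (\<lambda>i. D i \<omega>)) \<in> borel_measurable M"
    using indep_var_rv1[OF indep] by simp
  have "integrable M (\<lambda>\<omega>. g (\<lambda>i. D i \<omega>))"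
  proof (rule Bochner_Integration.integrable_bound[of _ "\<lambda>_. 1 :: real"])
    show "AE \<omega> in M. norm (g (\<lambda>i. D i \<omega>)) \<le> norm (1 :: real)"
      unfolding g_def by (auto intro!: AE_I2 prod_le_1 prod_nonneg simp: abs_prod)
  qed (use g_meas' in auto)
  moreover have inc: "sq_integrable M (\<lambda>\<omega>. W b \<omega> - W s \<omega>)"
    using s by (intro increment_sq_integrable)
  ultimately have "expectation (\<lambda>\<omega>. g (\<lambda>i. D i \<omega>) * (W b \<omega> - W s \<omega>)) =
      expectation (\<lambda>\<omega>. g (\<lambda>i. D i \<omega>)) * expectation (\<lambda>\<omega>. W b \<omega> - W s \<omega>)"
    using sq_integrable_imp_integrable by (intro indep_var_lebesgue_integral[OF indep])
  also have "\<dots> = 0"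
    using s by (simp only: increment_expectation mult_zero_right)
  finally have zero: "expectation (\<lambda>\<omega>. g (\<lambda>i. D i \<omega>) * (W b \<omega> - W s \<omega>)) = 0" .
  have A: "{\<omega> \<in> space M. \<forall>r\<in>R. W r \<omega> \<in> S r} \<in> sets M"
  proof -
    have "{\<omega> \<in> space M. W r \<omega> \<in> S r} \<in> sets M" if "r \<in> R" for r
    proof -
      have "W r \<in> borel_measurable M" using that R s by auto
      from measurable_sets[OF this S] show ?thesis
        by (simp add: vimage_def Int_def conj_commute)
    qed
    thus ?thesis using R by (intro sets.sets_Collect_finite_All) auto
  qed
  have "(LINT \<omega>:{\<omega> \<in> space M. \<forall>r\<in>R. W r \<omega> \<in> S r}|M. W b \<omega> - W s \<omega>) =
      expectation (\<lambda>\<omega>. g (\<lambda>i. D i \<omega>) * (W b \<omega> - W s \<omega>))"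
    unfolding set_lebesgue_integral_def
  proof (rule integral_cong_AE)
    show "AE \<omega> in M. indicator {\<omega> \<in> space M. \<forall>r\<in>R. W r \<omega> \<in> S r} \<omega> *\<^sub>R (W b \<omega> - W s \<omega>)
        = g (\<lambda>i. D i \<omega>) * (W b \<omega> - W s \<omega>)"
      using W_0 AE_space
    proof eventually_elim
      case (elim \<omega>)
      have "(\<Sum>i<idx r. D i \<omega>) = W r \<omega>" if "r \<in> R" for r
        using idx(2)[of r] that elim unfolding D_def
        by (subst sum_lessThan_telescope) (auto simp: p_0 T_def)
      hence "g (\<lambda>i. D i \<omega>) = (\<Prod>r\<in>R. indicator (S r) (W r \<omega>))"
        unfolding g_def by (intro prod.cong) auto
      also have "\<dots> = indicator {\<omega> \<in> space M. \<forall>r\<in>R. W r \<omega> \<in> S r} \<omega>"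
        using elim R(1) by (auto simp: indicator_def prod_eq_1_iff)
      finally show ?case by simp
    qed
  qed (use A g_meas' inc[THEN sq_integrable_measurable] in auto)
  thus ?thesis using zero by simp
qed

text \<open>A Dynkin argument for \<open>a = s\<close>: the cylinder events form an
  intersection-stable generator of the past. For later \<open>a\<close>, two increments starting at
  \<open>s\<close> are subtracted.\<close>

lemma increment_orthogonal:
  assumes s: "0 \<le> s" "s \<le> a" "a \<le> b" "b \<le> 1" and A: "A \<in> sets (\<F> s)"
  shows "(LINT \<omega>:A|M. W b \<omega> - W a \<omega>) = 0"
proof -
  have *: "(LINT \<omega>:A|M. W b \<omega> - W s \<omega>) = 0" if "s \<le> b" "b \<le> 1" for b
  proof -
    define D where "D = (\<lambda>\<omega>. W b \<omega> - W s \<omega>)"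
    have D: "integrable M D"
      unfolding D_def using s that by (intro sq_integrable_imp_integrable increment_sq_integrable) auto
    define G where "G = {{\<omega> \<in> space M. \<forall>r\<in>R. W r \<omega> \<in> S r} | R S. finite R \<and> R \<subseteq> {0..s} \<and> (\<forall>r. S r \<in> sets borel)}"
    have "G \<subseteq> sets (\<F> s)"
    proof
      fix X assume "X \<in> G"
      then obtain R S where X: "X = {\<omega> \<in> space M. \<forall>r\<in>R. W r \<omega> \<in> S r}"
        and R: "finite R" "R \<subseteq> {0..s}" "\<And>r. S r \<in> sets borel"
        unfolding G_def by blast
      have "{\<omega> \<in> space (\<F> s). W r \<omega> \<in> S r} \<in> sets (\<F> s)" if "r \<in> R" for r
      proof -
        have "W r \<in> borel_measurable (\<F> s)" using that R s by (intro W_adapted) auto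
        from measurable_sets[OF this R(3)] show ?thesis
          by (simp add: vimage_def Int_def conj_commute)
      qed
      thus "X \<in> sets (\<F> s)"
        unfolding X using R sets.sets_Collect_finite_All[of R "\<F> s"] by simp
    qed
    hence G_sub: "sigma_sets (space M) G \<subseteq> sets M"
      using sets.sigma_sets_subset[of G "\<F> s"] sets_natural_filtration_subset by auto
    have A_G: "A \<in> sigma_sets (space M) G"
    proof -
      have "{W s -` A \<inter> space M | s A. s \<in> {0..1} \<and> s \<le> t \<and> A \<in> sets borel} \<subseteq> G" if "t = s" for t
      proof safe
        fix r and S :: "real set" assume "r \<in> {0..1}" "r \<le> t" "S \<in> sets borel"
        thus "W r -` S \<inter> space M \<in> G"
          unfolding G_def that by (intro CollectI exI[of _ "{r}"] exI[of _ "\<lambda>_. S"]) auto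
      qed
      from sigma_sets_mono'[OF this[OF refl]] show ?thesis
        using A unfolding sets_natural_filtration by auto
    qed
    have "Int_stable G"
    proof (rule Int_stableI)
      fix X Y assume "X \<in> G" "Y \<in> G"
      then obtain R S R' S' where X: "X = {\<omega> \<in> space M. \<forall>r\<in>R. W r \<omega> \<in> S r}"
        "finite R" "R \<subseteq> {0..s}" "\<And>r. S r \<in> sets borel"
        and Y: "Y = {\<omega> \<in> space M. \<forall>r\<in>R'. W r \<omega> \<in> S' r}"
        "finite R'" "R' \<subseteq> {0..s}" "\<And>r. S' r \<in> sets borel"
        unfolding G_def by blast
      \<comment> \<open>The union of the two time sets carries both families of conditions, with
        \<open>UNIV\<close> wherever one of them imposes none.\<close>
      have "X \<inter> Y = {\<omega> \<in> space M. \<forall>r\<in>R \<union> R'. W r \<omega> \<in>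
          (if r \<in> R then S r else UNIV) \<inter> (if r \<in> R' then S' r else UNIV)}"
        unfolding X Y by auto
      thus "X \<inter> Y \<in> G"
        unfolding G_def using X Y
        by (intro CollectI exI[of _ "R \<union> R'"]
             exI[of _ "\<lambda>r. (if r \<in> R then S r else UNIV) \<inter> (if r \<in> R' then S' r else UNIV)"]) auto
    qed
    moreover have "G \<subseteq> Pow (space M)"
      by (auto simp: G_def)
    ultimately have "(LINT \<omega>:A|M. D \<omega>) = 0"
      using A_G
    proof (induction rule: sigma_sets_induct_disjoint[consumes 3])
      case (basic A)
      then obtain R S where "A = {\<omega> \<in> space M. \<forall>r\<in>R. W r \<omega> \<in> S r}"
        and "finite R" "R \<subseteq> {0..s}" "\<And>r. S r \<in> sets borel"
        unfolding G_def by blast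
      thus ?case
        unfolding D_def using increment_orthogonal_cylinder[of s b R S] that s by simp
    next
      case (compl A)
      have AM: "A \<in> sets M" using compl G_sub by auto
      have "(LINT \<omega>:space M - A|M. D \<omega>) = expectation (\<lambda>\<omega>. D \<omega> - indicator A \<omega> *\<^sub>R D \<omega>)"
        unfolding set_lebesgue_integral_def
        by (intro Bochner_Integration.integral_cong) (auto split: split_indicator)
      also have "\<dots> = expectation D - (LINT \<omega>:A|M. D \<omega>)"
        unfolding set_lebesgue_integral_def using D AM
        by (intro Bochner_Integration.integral_diff integrable_mult_indicator) auto
      finally show ?case
        using compl s that unfolding D_def by (simp only: increment_expectation)
    next
      case (union A)
      have "A i \<in> sets M" for i using union G_sub by auto
      moreover have "set_integrable M (\<Union>i. A i) D"
        unfolding set_integrable_def using D calculation by (intro integrable_mult_indicator) auto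
      ultimately show ?case
        using union by (subst lebesgue_integral_countable_add) (auto simp: disjoint_family_on_def)
    qed (simp add: set_lebesgue_integral_def)
    thus ?thesis by (simp add: D_def)
  qed
  have int: "set_integrable M A (\<lambda>\<omega>. W b \<omega> - W s \<omega>)" if "s \<le> b" "b \<le> 1" for b
    unfolding set_integrable_def using s that A sets_natural_filtration_subset
    by (intro integrable_mult_indicator sq_integrable_imp_integrable increment_sq_integrable) auto
  have "(LINT \<omega>:A|M. W b \<omega> - W a \<omega>) = (LINT \<omega>:A|M. (W b \<omega> - W s \<omega>) - (W a \<omega> - W s \<omega>))"
    by simp
  also have "\<dots> = 0"
    using s by (subst set_integral_diff) (auto simp: int * simp del: diff_diff_eq2 diff_right_commute)
  finally show ?thesis .
qed

text \<open>\<open>L'\<close> is the integral up to \<open>s\<close> and plays the role of the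
  conditional expectation of \<open>L\<close> given the past. For a basic pair it is
  \<open>W (min b s)\<close>.\<close>

lemma wiener_pair_split:
  assumes "wiener_pair W t h L" "t \<le> 1" "0 \<le> s" "s \<le> t"
  shows "\<exists>L'. wiener_pair W t (\<lambda>u. indicator {0<..s} u * h u) L' \<and>
    (\<forall>A\<in>sets (\<F> s). (LINT \<omega>:A|M. L \<omega> - L' \<omega>) = 0)"
  using assms
proof (induction rule: wiener_pair.induct)
  case (base b)
  have eq: "(\<lambda>u. indicator {0<..s} u * indicator {0<..b} u :: real) = indicator {0<..min b s}"
    by (auto simp: fun_eq_iff split: split_indicator)
  have "wiener_pair W t (indicator {0<..min b s}) (W (min b s))"
    using base by (intro wiener_pair.base) auto
  moreover have "(LINT \<omega>:A|M. W b \<omega> - W (min b s) \<omega>) = 0" if "A \<in> sets (\<F> s)" for A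
    using increment_orthogonal[of s s b A] base that by (cases "b \<le> s") (auto simp: min_def)
  ultimately show ?case
    unfolding eq by blast
next
  case zero
  thus ?case by (intro exI[of _ "\<lambda>_. 0"]) (auto intro: wiener_pair.zero)
next
  case (add h L h' L')
  then obtain K K' where K: "wiener_pair W t (\<lambda>u. indicator {0<..s} u * h u) K"
      "\<forall>A\<in>sets (\<F> s). (LINT \<omega>:A|M. L \<omega> - K \<omega>) = 0"
    and K': "wiener_pair W t (\<lambda>u. indicator {0<..s} u * h' u) K'"
      "\<forall>A\<in>sets (\<F> s). (LINT \<omega>:A|M. L' \<omega> - K' \<omega>) = 0"
    by blast
  have "sq_integrable M (\<lambda>\<omega>. L \<omega> - K \<omega>)" "sq_integrable M (\<lambda>\<omega>. L' \<omega> - K' \<omega>)"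
    using wiener_pair_sq_integrable(2)[OF _ \<open>t \<le> 1\<close>] add.hyps K(1) K'(1)
    by (blast intro: sq_integrable_diff)+
  hence int: "integrable M (\<lambda>\<omega>. L \<omega> - K \<omega>)" "integrable M (\<lambda>\<omega>. L' \<omega> - K' \<omega>)"
    by (auto intro: sq_integrable_imp_integrable)
  have "(LINT \<omega>:A|M. (L \<omega> + L' \<omega>) - (K \<omega> + K' \<omega>)) = 0" if A: "A \<in> sets (\<F> s)" for A
  proof -
    have "A \<in> sets M" using A sets_natural_filtration_subset by blast
    hence si: "set_integrable M A (\<lambda>\<omega>. L \<omega> - K \<omega>)" "set_integrable M A (\<lambda>\<omega>. L' \<omega> - K' \<omega>)"
      unfolding set_integrable_def using int by (intro integrable_mult_indicator; simp)+
    have "(LINT \<omega>:A|M. (L \<omega> + L' \<omega>) - (K \<omega> + K' \<omega>)) = (LINT \<omega>:A|M. (L \<omega> - K \<omega>) + (L' \<omega> - K' \<omega>))"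
      by (simp add: algebra_simps)
    also have "\<dots> = (LINT \<omega>:A|M. L \<omega> - K \<omega>) + (LINT \<omega>:A|M. L' \<omega> - K' \<omega>)"
      by (rule set_integral_add(2)[OF si])
    also have "\<dots> = 0" using K K' A by simp
    finally show ?thesis .
  qed
  moreover have "wiener_pair W t (\<lambda>u. indicator {0<..s} u * (h u + h' u)) (\<lambda>\<omega>. K \<omega> + K' \<omega>)"
    unfolding ring_distribs by (intro wiener_pair.add K K')
  ultimately show ?case by blast
next
  case (cmult h L c)
  then obtain K where K: "wiener_pair W t (\<lambda>u. indicator {0<..s} u * h u) K"
      "\<forall>A\<in>sets (\<F> s). (LINT \<omega>:A|M. L \<omega> - K \<omega>) = 0"
    by blast
  have "wiener_pair W t (\<lambda>u. c * (indicator {0<..s} u * h u)) (\<lambda>\<omega>. c * K \<omega>)"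
    by (intro wiener_pair.cmult K)
  moreover have "(LINT \<omega>:A|M. c * L \<omega> - c * K \<omega>) = c * (LINT \<omega>:A|M. L \<omega> - K \<omega>)" for A
    by (simp add: right_diff_distrib[symmetric])
  ultimately show ?case
    using K by (intro exI[of _ "\<lambda>\<omega>. c * K \<omega>"]) (auto simp: mult.left_commute)
qed

end

section \<open>The Wiener integral\<close>

text \<open>Bridge from the nonnegative integrals in \<open>has_wiener_integral\<close> to
  \<open>L2_norm\<close>: a finite bound there also yields square-integrability.\<close>

lemma L2_norm_lessI:
  assumes u: "u \<in> borel_measurable M" and "e > 0"
    and less: "(\<integral>\<^sup>+x. ennreal ((u x)\<^sup>2) \<partial>M) < ennreal (e\<^sup>2)"
  shows "sq_integrable M u" "L2_norm M u < e"
proof -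
  have int: "integrable M (\<lambda>x. (u x)\<^sup>2)"
  proof (rule integrableI_bounded)
    show "(\<integral>\<^sup>+x. ennreal (norm ((u x)\<^sup>2)) \<partial>M) < \<infinity>"
      using less by (simp add: less_top[symmetric]) (metis ennreal_less_top less_asym top.not_eq_extremum)
  qed (use u in auto)
  thus "sq_integrable M u"
    using u by (simp add: sq_integrable_def)
  have "ennreal (\<integral>x. (u x)\<^sup>2 \<partial>M) < ennreal (e\<^sup>2)"
    using less int by (subst (asm) nn_integral_eq_integral) auto
  hence "(L2_norm M u)\<^sup>2 < e\<^sup>2"
    unfolding L2_norm_square using \<open>e > 0\<close> by (simp add: ennreal_less_iff)
  thus "L2_norm M u < e"
    using \<open>e > 0\<close> by (simp add: power2_less_imp_less)
qed

context brownian
begin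

text \<open>The \<open>L\<^sup>2\<close>-closure of the pairs. In contrast to \<^const>\<open>has_wiener_integral\<close>, the approximating
  step functions need not come from a single monotone partition.\<close>

definition wiener_int :: "real \<Rightarrow> (real \<Rightarrow> real) \<Rightarrow> ('a \<Rightarrow> real) \<Rightarrow> bool" where
  "wiener_int t g Y \<longleftrightarrow> (\<forall>e>0. \<exists>h L. wiener_pair W t h L \<and>
     sq_integrable lborel (\<lambda>s. g s - h s) \<and> L2_norm lborel (\<lambda>s. g s - h s) < e \<and>
     sq_integrable M (\<lambda>\<omega>. Y \<omega> - L \<omega>) \<and> L2_norm M (\<lambda>\<omega>. Y \<omega> - L \<omega>) < e)"

lemma wiener_intE:
  assumes "wiener_int t g Y" "e > 0"
  obtains h L where "wiener_pair W t h L"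
     "sq_integrable lborel (\<lambda>s. g s - h s)" "L2_norm lborel (\<lambda>s. g s - h s) < e"
     "sq_integrable M (\<lambda>\<omega>. Y \<omega> - L \<omega>)" "L2_norm M (\<lambda>\<omega>. Y \<omega> - L \<omega>) < e"
  using assms unfolding wiener_int_def by blast

lemma wiener_int_pair:
  assumes "wiener_pair W t h L"
  shows "wiener_int t h L"
  unfolding wiener_int_def using assms
  by (intro allI impI exI[of _ h] exI[of _ L]) (auto simp: L2_norm_def sq_integrable_def)

lemma wiener_int_mono:
  assumes "wiener_int s g Y" "s \<le> t"
  shows "wiener_int t g Y"
  using assms wiener_pair_mono unfolding wiener_int_def by meson

lemma wiener_int_diff:
  assumes "wiener_int t g Y" "wiener_int t g' Y'"
  shows "wiener_int t (\<lambda>s. g s - g' s) (\<lambda>\<omega>. Y \<omega> - Y' \<omega>)"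
  unfolding wiener_int_def
proof (intro allI impI)
  fix e :: real assume "e > 0"
  hence "e / 2 > 0" by simp
  obtain h L where 1: "wiener_pair W t h L"
     "sq_integrable lborel (\<lambda>s. g s - h s)" "L2_norm lborel (\<lambda>s. g s - h s) < e / 2"
     "sq_integrable M (\<lambda>\<omega>. Y \<omega> - L \<omega>)" "L2_norm M (\<lambda>\<omega>. Y \<omega> - L \<omega>) < e / 2"
    by (rule wiener_intE[OF assms(1) \<open>e / 2 > 0\<close>])
  obtain h' L' where 2: "wiener_pair W t h' L'"
     "sq_integrable lborel (\<lambda>s. g' s - h' s)" "L2_norm lborel (\<lambda>s. g' s - h' s) < e / 2"
     "sq_integrable M (\<lambda>\<omega>. Y' \<omega> - L' \<omega>)" "L2_norm M (\<lambda>\<omega>. Y' \<omega> - L' \<omega>) < e / 2"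
    by (rule wiener_intE[OF assms(2) \<open>e / 2 > 0\<close>])
  \<comment> \<open>Stated for an arbitrary measure because it is applied both on the time axis and
    on the probability space.\<close>
  have *: "sq_integrable N (\<lambda>x. f x - f' x - (k x - k' x)) \<and> L2_norm N (\<lambda>x. f x - f' x - (k x - k' x)) < e"
    if "sq_integrable N (\<lambda>x. f x - k x)" "L2_norm N (\<lambda>x. f x - k x) < e / 2"
      "sq_integrable N (\<lambda>x. f' x - k' x)" "L2_norm N (\<lambda>x. f' x - k' x) < e / 2"
    for N :: "'c measure" and f f' k k'
  proof -
    have "sq_integrable N (\<lambda>x. (f x - k x) + (k' x - f' x))"
      using sq_integrable_diff[OF that(1,3)] by (simp add: algebra_simps)
    moreover have "L2_norm N (\<lambda>x. (f x - k x) + (k' x - f' x)) < e"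
      using L2_norm_triangle[OF that(1) sq_integrable_cmult[OF that(3), of "-1"]] that(2,4)
      by (simp add: L2_norm_minus[of N k' f'])
    moreover have "(f x - k x) + (k' x - f' x) = f x - f' x - (k x - k' x)" for x
      by simp
    ultimately show ?thesis by (simp only:)
  qed
  show "\<exists>h L. wiener_pair W t h L \<and>
     sq_integrable lborel (\<lambda>s. g s - g' s - h s) \<and> L2_norm lborel (\<lambda>s. g s - g' s - h s) < e \<and>
     sq_integrable M (\<lambda>\<omega>. Y \<omega> - Y' \<omega> - L \<omega>) \<and> L2_norm M (\<lambda>\<omega>. Y \<omega> - Y' \<omega> - L \<omega>) < e"
    using wiener_pair_diff[OF 1(1) 2(1)] *[OF 1(2,3) 2(2,3)] *[OF 1(4,5) 2(4,5)] by blast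
qed

lemma wiener_int_cmult:
  assumes "wiener_int t g Y"
  shows "wiener_int t (\<lambda>s. c * g s) (\<lambda>\<omega>. c * Y \<omega>)"
  unfolding wiener_int_def
proof (intro allI impI)
  fix e :: real assume "e > 0"
  \<comment> \<open>The summand 1 covers \<open>c = 0\<close>.\<close>
  hence e: "e / (\<bar>c\<bar> + 1) > 0" by simp
  obtain h L where 1: "wiener_pair W t h L"
     "sq_integrable lborel (\<lambda>s. g s - h s)" "L2_norm lborel (\<lambda>s. g s - h s) < e / (\<bar>c\<bar> + 1)"
     "sq_integrable M (\<lambda>\<omega>. Y \<omega> - L \<omega>)" "L2_norm M (\<lambda>\<omega>. Y \<omega> - L \<omega>) < e / (\<bar>c\<bar> + 1)"
    by (rule wiener_intE[OF assms e])
  have *: "\<bar>c\<bar> * x < e" if "x < e / (\<bar>c\<bar> + 1)" "x \<ge> 0" for x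
  proof -
    have "\<bar>c\<bar> * x \<le> (\<bar>c\<bar> + 1) * x"
      using that by (intro mult_right_mono) auto
    also have "\<dots> < e"
      using that by (simp add: field_simps)
    finally show ?thesis .
  qed
  show "\<exists>h L. wiener_pair W t h L \<and>
     sq_integrable lborel (\<lambda>s. c * g s - h s) \<and> L2_norm lborel (\<lambda>s. c * g s - h s) < e \<and>
     sq_integrable M (\<lambda>\<omega>. c * Y \<omega> - L \<omega>) \<and> L2_norm M (\<lambda>\<omega>. c * Y \<omega> - L \<omega>) < e"
    using wiener_pair.cmult[OF 1(1), of c] 1 *
    by (intro exI[of _ "\<lambda>s. c * h s"] exI[of _ "\<lambda>\<omega>. c * L \<omega>"])
       (simp add: right_diff_distrib[symmetric] sq_integrable_cmult L2_norm_cmult)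
qed

lemma wiener_int_sq_integrable:
  assumes "wiener_int t g Y" "t \<le> 1"
  shows "sq_integrable lborel g" "sq_integrable M Y"
proof -
  obtain h L where *: "wiener_pair W t h L"
     "sq_integrable lborel (\<lambda>s. g s - h s)" "sq_integrable M (\<lambda>\<omega>. Y \<omega> - L \<omega>)"
    by (rule wiener_intE[OF assms(1) zero_less_one])
  show "sq_integrable lborel g" "sq_integrable M Y"
    using sq_integrable_add[OF *(2) wiener_pair_sq_integrable(1)[OF *(1) assms(2)]]
      sq_integrable_add[OF *(3) wiener_pair_sq_integrable(2)[OF *(1) assms(2)]] by simp_all
qed

text \<open>An approximating pair has the same norm on both sides, and each of the two norms in
  question is within \<open>e\<close> of it; with \<open>e\<close> half of their distance this is
  impossible.\<close>

lemma wiener_int_isometry: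
  assumes "wiener_int t g Y" "t \<le> 1"
  shows "L2_norm M Y = L2_norm lborel g"
proof (rule ccontr)
  define e where "e = \<bar>L2_norm M Y - L2_norm lborel g\<bar> / 2"
  assume "L2_norm M Y \<noteq> L2_norm lborel g"
  hence e: "e > 0" by (simp add: e_def)
  obtain h L where *: "wiener_pair W t h L"
     "sq_integrable lborel (\<lambda>s. g s - h s)" "L2_norm lborel (\<lambda>s. g s - h s) < e"
     "sq_integrable M (\<lambda>\<omega>. Y \<omega> - L \<omega>)" "L2_norm M (\<lambda>\<omega>. Y \<omega> - L \<omega>) < e"
    by (rule wiener_intE[OF assms(1) e])
  note sq = wiener_pair_sq_integrable[OF *(1) assms(2)] wiener_int_sq_integrable[OF assms]
  have "\<bar>L2_norm M Y - L2_norm M L\<bar> < e" "\<bar>L2_norm lborel g - L2_norm lborel h\<bar> < e"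
    using L2_norm_triangle_diff[OF sq(4,2)] L2_norm_triangle_diff[OF sq(3,1)] * by simp_all
  thus False
    using wiener_pair_isometry[OF *(1) assms(2)] by (simp add: e_def abs_if split: if_splits)
qed

lemma expectation_indicator_le_L2_norm:
  assumes "sq_integrable M Z" "A \<in> sets M"
  shows "\<bar>expectation (\<lambda>\<omega>. indicator A \<omega> * Z \<omega>)\<bar> \<le> L2_norm M Z"
  using expectation_diff_le_L2_norm[of "\<lambda>\<omega>. indicator A \<omega> * Z \<omega>" "\<lambda>_. 0" Z] assms
    integrable_mult_indicator[OF assms(2) sq_integrable_imp_integrable[OF assms(1)]]
  by (auto simp: indicator_def)

lemma integrable_indicator_mult:
  assumes "sq_integrable M Z" "A \<in> sets M"
  shows "integrable M (\<lambda>\<omega>. indicator A \<omega> * Z \<omega>)"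
  using integrable_mult_indicator[OF assms(2) sq_integrable_imp_integrable[OF assms(1)]] by simp

text \<open>Write \<open>Y = (Y - L) + (L - L') + L'\<close> with \<open>L'\<close> from
  \<open>wiener_pair_split\<close>. The middle term integrates to 0 over \<open>A\<close> and the
  outer ones are small in \<open>L\<^sup>2\<close>.\<close>

lemma wiener_int_orthogonal:
  assumes Y: "wiener_int t g Y" and st: "0 \<le> s" "s \<le> t" "t \<le> 1"
    and g: "\<And>u. u \<in> {0<..s} \<Longrightarrow> g u = 0" and A: "A \<in> sets (\<F> s)"
  shows "expectation (\<lambda>\<omega>. indicator A \<omega> * Y \<omega>) = 0"
proof (rule ccontr)
  define e where "e = \<bar>expectation (\<lambda>\<omega>. indicator A \<omega> * Y \<omega>)\<bar> / 2"
  assume "expectation (\<lambda>\<omega>. indicator A \<omega> * Y \<omega>) \<noteq> 0"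
  hence e: "e > 0" by (simp add: e_def)
  obtain h L where *: "wiener_pair W t h L"
     "sq_integrable lborel (\<lambda>s. g s - h s)" "L2_norm lborel (\<lambda>s. g s - h s) < e"
     "sq_integrable M (\<lambda>\<omega>. Y \<omega> - L \<omega>)" "L2_norm M (\<lambda>\<omega>. Y \<omega> - L \<omega>) < e"
    by (rule wiener_intE[OF Y e])
  obtain L' where L': "wiener_pair W t (\<lambda>u. indicator {0<..s} u * h u) L'"
    "(LINT \<omega>:A|M. L \<omega> - L' \<omega>) = 0"
    using wiener_pair_split[OF *(1) st(3,1,2)] A by blast
  have AM: "A \<in> sets M"
    using A sets_natural_filtration_subset by auto
  note sqL = wiener_pair_sq_integrable[OF *(1) st(3)]
  note sqL' = wiener_pair_sq_integrable[OF L'(1) st(3)]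
  have "L2_norm M L' = L2_norm lborel (\<lambda>u. indicator {0<..s} u * h u)"
    by (rule wiener_pair_isometry[OF L'(1) st(3)])
  \<comment> \<open>Since \<open>g\<close> vanishes on \<open>{0<..s}\<close>, the part of
    \<open>h\<close> there is itself part of the approximation error.\<close>
  also have "\<dots> \<le> L2_norm lborel (\<lambda>u. g u - h u)"
    using sqL'(1) g by (intro L2_norm_mono *) (auto intro!: AE_I2 simp: sq_integrable_def indicator_def)
  finally have nL': "L2_norm M L' < e"
    using * by simp
  have "expectation (\<lambda>\<omega>. indicator A \<omega> * Y \<omega>) =
    expectation (\<lambda>\<omega>. indicator A \<omega> * (Y \<omega> - L \<omega>) + indicator A \<omega> * (L \<omega> - L' \<omega>) + indicator A \<omega> * L' \<omega>)"
    by (simp add: algebra_simps)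
  also have "\<dots> = expectation (\<lambda>\<omega>. indicator A \<omega> * (Y \<omega> - L \<omega>)) +
      expectation (\<lambda>\<omega>. indicator A \<omega> * (L \<omega> - L' \<omega>)) + expectation (\<lambda>\<omega>. indicator A \<omega> * L' \<omega>)"
    by (simp add: integrable_indicator_mult AM sqL' * sq_integrable_diff[OF sqL(2) sqL'(2)]
        del: Bochner_Integration.integral_mult_right)
  also have "expectation (\<lambda>\<omega>. indicator A \<omega> * (L \<omega> - L' \<omega>)) = 0"
    using L'(2) by (simp add: set_lebesgue_integral_def)
  finally have "\<bar>expectation (\<lambda>\<omega>. indicator A \<omega> * Y \<omega>)\<bar> \<le>
     \<bar>expectation (\<lambda>\<omega>. indicator A \<omega> * (Y \<omega> - L \<omega>))\<bar> + \<bar>expectation (\<lambda>\<omega>. indicator A \<omega> * L' \<omega>)\<bar>"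
    by simp
  also have "\<dots> \<le> L2_norm M (\<lambda>\<omega>. Y \<omega> - L \<omega>) + L2_norm M L'"
    by (intro add_mono expectation_indicator_le_L2_norm AM sqL' *)
  also have "\<dots> < 2 * e"
    using * nL' by simp
  finally show False by (simp add: e_def)
qed

section \<open>Positive parts: the submartingale inequality and the Gaussian bound\<close>

lemma sq_integrable_pos_part: "sq_integrable M Y \<Longrightarrow> sq_integrable M (\<lambda>\<omega>. max 0 (Y \<omega>))"
  by (rule sq_integrable_bound[of M Y]) (auto simp: sq_integrable_def)

text \<open>Jensen's inequality without conditional expectations. On \<open>A\<close> the positive
  part of \<open>Y\<close> is selected by an event \<open>G\<close> of the past, orthogonality
  replaces \<open>Y\<close> by \<open>Z\<close> on \<open>G\<close>, and \<open>Z\<close> on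
  \<open>G\<close> is at most its positive part on \<open>A\<close>.\<close>

lemma wiener_int_submartingale:
  assumes Y: "wiener_int s g Y" and Z: "wiener_int t g' Z" and st: "0 \<le> s" "s \<le> t" "t \<le> 1"
    and g: "\<And>u. u \<in> {0<..s} \<Longrightarrow> g u = g' u" and A: "A \<in> sets (\<F> s)"
  shows "expectation (\<lambda>\<omega>. indicator A \<omega> * max 0 (Y \<omega>)) \<le> expectation (\<lambda>\<omega>. indicator A \<omega> * max 0 (Z \<omega>))"
proof (rule field_le_epsilon)
  fix e :: real assume "e > 0"
  hence e: "e / 2 > 0" by simp
  have "s \<le> 1" using st by simp
  obtain h L where *: "wiener_pair W s h L"
     "sq_integrable M (\<lambda>\<omega>. Y \<omega> - L \<omega>)" "L2_norm M (\<lambda>\<omega>. Y \<omega> - L \<omega>) < e / 2"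
    by (rule wiener_intE[OF Y e])
  \<comment> \<open>The filtration is not completed, so \<open>Y\<close> itself need not be
    measurable at time \<open>s\<close>. The approximating \<open>L\<close> is, and its sign defines
    the event at the cost of two errors \<open>e / 2\<close>.\<close>
  define G where "G = A \<inter> {\<omega> \<in> space M. L \<omega> > 0}"
  have "{\<omega> \<in> space M. L \<omega> > 0} = L -` {0<..} \<inter> space (\<F> s)"
    by auto
  also have "\<dots> \<in> sets (\<F> s)"
    by (rule measurable_sets[OF wiener_pair_adapted[OF *(1) \<open>s \<le> 1\<close>]]) auto
  finally have G: "G \<in> sets (\<F> s)"
    unfolding G_def using A by auto
  have AM: "A \<in> sets M" and GM: "G \<in> sets M"
    using A G sets_natural_filtration_subset by auto
  have sq: "sq_integrable M L" "sq_integrable M Y" "sq_integrable M Z"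
    using wiener_pair_sq_integrable(2)[OF *(1)] wiener_int_sq_integrable(2)[OF Y]
      wiener_int_sq_integrable(2)[OF Z] st by auto
  note int = integrable_indicator_mult[OF _ AM] integrable_indicator_mult[OF _ GM]
  have "expectation (\<lambda>\<omega>. indicator A \<omega> * max 0 (Y \<omega>)) \<le> expectation (\<lambda>\<omega>. indicator A \<omega> * max 0 (L \<omega>)) + e / 2"
    using expectation_diff_le_L2_norm[OF int(1)[OF sq_integrable_pos_part[OF sq(2)]]
        int(1)[OF sq_integrable_pos_part[OF sq(1)]] *(2)] *(3)
    by (force simp: indicator_def max_def)
  also have "expectation (\<lambda>\<omega>. indicator A \<omega> * max 0 (L \<omega>)) = expectation (\<lambda>\<omega>. indicator G \<omega> * L \<omega>)"
    by (intro Bochner_Integration.integral_cong) (auto simp: G_def indicator_def max_def)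
  also have "\<dots> \<le> expectation (\<lambda>\<omega>. indicator G \<omega> * Y \<omega>) + e / 2"
    using expectation_diff_le_L2_norm[OF int(2)[OF sq(2)] int(2)[OF sq(1)] *(2)] *(3)
    by (force simp: indicator_def)
  also have "expectation (\<lambda>\<omega>. indicator G \<omega> * Y \<omega>) = expectation (\<lambda>\<omega>. indicator G \<omega> * Z \<omega>)"
  proof -
    have "expectation (\<lambda>\<omega>. indicator G \<omega> * (Z \<omega> - Y \<omega>)) = 0"
      using st g G
      by (intro wiener_int_orthogonal[OF wiener_int_diff[OF Z wiener_int_mono[OF Y]]]) auto
    thus ?thesis
      using int(2) sq by (simp add: right_diff_distrib)
  qed
  also have "expectation (\<lambda>\<omega>. indicator G \<omega> * Z \<omega>) \<le> expectation (\<lambda>\<omega>. indicator A \<omega> * max 0 (Z \<omega>))"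
    using int sq sq_integrable_pos_part[OF sq(3)]
    by (intro integral_mono) (auto simp: G_def indicator_def)
  finally show "expectation (\<lambda>\<omega>. indicator A \<omega> * max 0 (Y \<omega>)) \<le> expectation (\<lambda>\<omega>. indicator A \<omega> * max 0 (Z \<omega>)) + e"
    by simp
qed

text \<open>One step function from the defining sequence serves for all conclusions. The last one is
  recorded here because it depends on the ordered partition, which is forgotten in
  \<open>wiener_int\<close>.\<close>

lemma has_wiener_integral_approx:
  assumes Y: "has_wiener_integral M W f t Y" and t: "0 \<le> t" "t \<le> 1" and e: "e > 0"
  shows "\<exists>h L. wiener_pair W t h L \<and>
     sq_integrable lborel (\<lambda>s. indicator {0<..t} s * f s - h s) \<and>
     L2_norm lborel (\<lambda>s. indicator {0<..t} s * f s - h s) < e \<and>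
     sq_integrable M (\<lambda>\<omega>. Y \<omega> - L \<omega>) \<and> L2_norm M (\<lambda>\<omega>. Y \<omega> - L \<omega>) < e \<and>
     expectation (\<lambda>\<omega>. max 0 (L \<omega>)) = L2_norm M L / sqrt (2 * pi)"
proof -
  obtain n p c where p: "\<And>k. mono_on {..n k} (p k)" "\<And>k. p k ` {..n k} \<subseteq> {0..t}"
    and lim: "(\<lambda>k::nat. \<integral>\<^sup>+s\<in>{0..t}. ennreal ((f s - step_fun (n k) (p k) (c k) s)\<^sup>2) \<partial>lborel) \<longlonglongrightarrow> 0"
      "(\<lambda>k. \<integral>\<^sup>+\<omega>. ennreal ((Y \<omega> - step_integral W (n k) (p k) (c k) \<omega>)\<^sup>2) \<partial>M) \<longlonglongrightarrow> 0"
    using Y unfolding has_wiener_integral_def by blast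
  have "0 < ennreal (e\<^sup>2)" using e by simp
  from eventually_conj[OF order_tendstoD(2)[OF lim(1) this] order_tendstoD(2)[OF lim(2) this]]
  obtain k where k: "(\<integral>\<^sup>+s\<in>{0..t}. ennreal ((f s - step_fun (n k) (p k) (c k) s)\<^sup>2) \<partial>lborel) < ennreal (e\<^sup>2)"
      "(\<integral>\<^sup>+\<omega>. ennreal ((Y \<omega> - step_integral W (n k) (p k) (c k) \<omega>)\<^sup>2) \<partial>M) < ennreal (e\<^sup>2)"
    using eventually_happens' sequentially_bot by blast
  define h where "h = step_fun (n k) (p k) (c k)"
  define L where "L = step_integral W (n k) (p k) (c k)"
  have hL: "wiener_pair W t h L"
    unfolding h_def L_def by (rule wiener_pair_step[OF p])
  note sq = wiener_pair_sq_integrable[OF hL t(2)]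
  have "(\<lambda>x. indicator {0..t} x *\<^sub>R f x) \<in> borel_measurable lborel" "Y \<in> borel_measurable M"
    using Y by (auto simp: has_wiener_integral_def set_borel_measurable_def)
  hence "(\<lambda>x. indicator {0<..t} x * (indicator {0..t} x *\<^sub>R f x)) \<in> borel_measurable lborel"
    by (intro borel_measurable_times) auto
  also have "(\<lambda>x. indicator {0<..t} x * (indicator {0..t} x *\<^sub>R f x)) = (\<lambda>x. indicator {0<..t} x * f x)"
    by (auto simp: fun_eq_iff indicator_def)
  finally have meas: "(\<lambda>s. indicator {0<..t} s * f s - h s) \<in> borel_measurable lborel"
    using sq by (intro borel_measurable_diff) (auto simp: sq_integrable_def)
  have "(\<integral>\<^sup>+s. ennreal ((indicator {0<..t} s * f s - h s)\<^sup>2) \<partial>lborel) \<le>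
      (\<integral>\<^sup>+s\<in>{0..t}. ennreal ((f s - h s)\<^sup>2) \<partial>lborel)"
    using wiener_pair_supp[OF hL] by (intro nn_integral_mono) (auto simp: indicator_def)
  also have "\<dots> < ennreal (e\<^sup>2)"
    using k by (simp add: h_def)
  finally have "sq_integrable lborel (\<lambda>s. indicator {0<..t} s * f s - h s)"
     "L2_norm lborel (\<lambda>s. indicator {0<..t} s * f s - h s) < e"
    using L2_norm_lessI[OF meas e] by auto
  moreover have "sq_integrable M (\<lambda>\<omega>. Y \<omega> - L \<omega>)" "L2_norm M (\<lambda>\<omega>. Y \<omega> - L \<omega>) < e"
    using L2_norm_lessI[OF _ e k(2)] \<open>Y \<in> _\<close> sq by (auto simp: L_def sq_integrable_def)
  moreover have "expectation (\<lambda>\<omega>. max 0 (L \<omega>)) = L2_norm M L / sqrt (2 * pi)"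
    unfolding L_def by (rule step_integral_pos_part[OF p(1)]) (use p(2)[of k] t in auto)
  ultimately show ?thesis using hL by blast
qed

lemma has_wiener_integral_imp_wiener_int:
  assumes "has_wiener_integral M W f t Y" "0 \<le> t" "t \<le> 1"
  shows "wiener_int t (\<lambda>s. indicator {0<..t} s * f s) Y"
  unfolding wiener_int_def using has_wiener_integral_approx[OF assms] by blast

text \<open>Inherited from the step integrals, since both sides are continuous in
  \<open>L\<^sup>2\<close>; the law of \<open>Y\<close> itself need not be identified.\<close>

lemma has_wiener_integral_pos_part:
  assumes "has_wiener_integral M W f t Y" "0 \<le> t" "t \<le> 1"
  shows "expectation (\<lambda>\<omega>. max 0 (Y \<omega>)) \<le> L2_norm M Y / sqrt (2 * pi)"
proof (rule field_le_epsilon)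
  fix e :: real assume "e > 0"
  hence e: "e / 2 > 0" by simp
  from has_wiener_integral_approx[OF assms e] obtain h L where *: "wiener_pair W t h L"
     "sq_integrable M (\<lambda>\<omega>. Y \<omega> - L \<omega>)" "L2_norm M (\<lambda>\<omega>. Y \<omega> - L \<omega>) < e / 2"
     "expectation (\<lambda>\<omega>. max 0 (L \<omega>)) = L2_norm M L / sqrt (2 * pi)"
    by blast
  have sq: "sq_integrable M L" "sq_integrable M Y"
    using wiener_pair_sq_integrable(2)[OF *(1)]
      wiener_int_sq_integrable(2)[OF has_wiener_integral_imp_wiener_int[OF assms]] assms by auto
  have "\<bar>expectation (\<lambda>\<omega>. max 0 (Y \<omega>)) - expectation (\<lambda>\<omega>. max 0 (L \<omega>))\<bar> \<le> L2_norm M (\<lambda>\<omega>. Y \<omega> - L \<omega>)"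
    using sq * by (intro expectation_diff_le_L2_norm sq_integrable_imp_integrable sq_integrable_pos_part) auto
  hence "expectation (\<lambda>\<omega>. max 0 (Y \<omega>)) \<le> L2_norm M L / sqrt (2 * pi) + e / 2"
    using * by linarith
  also have "\<dots> \<le> (L2_norm M Y + e / 2) / sqrt (2 * pi) + e / 2"
    using L2_norm_triangle_diff[OF sq] * L2_norm_minus[of M Y L]
    by (intro add_right_mono divide_right_mono) auto
  also have "\<dots> = L2_norm M Y / sqrt (2 * pi) + (e / 2) / sqrt (2 * pi) + e / 2"
    by (simp add: add_divide_distrib)
  also have "(e / 2) / sqrt (2 * pi) \<le> e / 2"
    using e pi_ge_two by (simp add: divide_le_eq)
  finally show "expectation (\<lambda>\<omega>. max 0 (Y \<omega>)) \<le> L2_norm M Y / sqrt (2 * pi) + e"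
    by simp
qed

end

section \<open>Bounds for the optimal stopping value\<close>

text \<open>The square integrates to \<open>(1 - (1 - t) powr k) / k\<close> with
  \<open>k = 1 - 2\<alpha>\<close>, and \<open>k > 0\<close> makes the bound uniform in
  \<open>t < 1\<close>. This controls the variance of the martingale below.\<close>

lemma L2_norm_weight_le:
  fixes \<alpha> t :: real
  assumes \<alpha>: "0 < \<alpha>" "\<alpha> < 1/2" and t: "0 \<le> t" "t < 1"
  shows "L2_norm lborel (\<lambda>u. indicator {0<..t} u * (1 - u) powr (- \<alpha>)) \<le> 1 / sqrt (1 - 2 * \<alpha>)"
proof -
  define k where "k = 1 - 2 * \<alpha>"
  have k: "k > 0" using \<alpha> by (simp add: k_def)
  have hb: "has_bochner_integral lborel (\<lambda>u. (1 - u) powr (- 2 * \<alpha>) * indicator {0..t} u)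
      (- ((1 - t) powr k / k) - (- ((1 - 0) powr k / k)))"
  proof (rule has_bochner_integral_FTC_Icc_real)
    fix u assume u: "0 \<le> u" "u \<le> t"
    show "((\<lambda>u. - ((1 - u) powr k / k)) has_real_derivative (1 - u) powr (- 2 * \<alpha>)) (at u)"
      using u t k by (auto intro!: derivative_eq_intros simp: k_def)
    show "isCont (\<lambda>u. (1 - u) powr (- 2 * \<alpha>)) u"
      using u t by (intro continuous_intros) auto
  qed (use t in auto)
  have "(\<integral>u. (indicator {0<..t} u * (1 - u) powr (- \<alpha>))\<^sup>2 \<partial>lborel)
      \<le> (\<integral>u. (1 - u) powr (- 2 * \<alpha>) * indicator {0..t} u \<partial>lborel)"
  proof (rule integral_mono')
    show "integrable lborel (\<lambda>u. (1 - u) powr (- 2 * \<alpha>) * indicator {0..t} u)"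
      using hb by (rule integrable.intros)
    fix u
    have "((1 - u) powr (- \<alpha>))\<^sup>2 = (1 - u) powr (- 2 * \<alpha>)"
      by (simp add: power2_eq_square powr_add[symmetric])
    thus "(indicator {0<..t} u * (1 - u) powr (- \<alpha>))\<^sup>2 \<le> (1 - u) powr (- 2 * \<alpha>) * indicator {0..t} u"
      by (auto simp: indicator_def)
  qed (auto simp: indicator_def)
  also have "\<dots> = (1 - (1 - t) powr k) / k"
    using has_bochner_integral_integral_eq[OF hb] by (simp add: diff_divide_distrib)
  also have "\<dots> \<le> 1 / k"
    using k by (intro divide_right_mono) auto
  finally have "L2_norm lborel (\<lambda>u. indicator {0<..t} u * (1 - u) powr (- \<alpha>)) \<le> sqrt (1 / k)"
    unfolding L2_norm_def by (rule real_sqrt_le_mono)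
  thus ?thesis
    by (simp add: k_def real_sqrt_divide)
qed

section \<open>The bridge and its associated martingale\<close>

locale brownian_bridge = brownian M W for M :: "'a measure" and W +
  fixes \<alpha> :: real and X :: "real \<Rightarrow> 'a \<Rightarrow> real"
  assumes \<alpha>: "0 < \<alpha>" "\<alpha> < 1/2" and X: "alpha_bridge M W \<alpha> X"
begin

lemma X_integral:
  "0 \<le> t \<Longrightarrow> t < 1 \<Longrightarrow> has_wiener_integral M W (\<lambda>s. ((1 - t) / (1 - s)) powr \<alpha>) t (X t)"
  using X by (auto simp: alpha_bridge_def)

lemma X_continuous: "\<omega> \<in> space M \<Longrightarrow> continuous_on {0..<1} (\<lambda>t. X t \<omega>)"
  using X by (auto simp: alpha_bridge_def)

lemma X_1: "\<omega> \<in> space M \<Longrightarrow> X 1 \<omega> = 0"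
  using X by (auto simp: alpha_bridge_def)

lemma X_wiener_int:
  "0 \<le> t \<Longrightarrow> t < 1 \<Longrightarrow> wiener_int t (\<lambda>s. indicator {0<..t} s * ((1 - t) / (1 - s)) powr \<alpha>) (X t)"
  by (intro has_wiener_integral_imp_wiener_int X_integral) auto

definition N :: "real \<Rightarrow> 'a \<Rightarrow> real" where
  "N t \<omega> = (1 - t) powr (- \<alpha>) * X t \<omega>"

text \<open>The factor cancels the dependence of the integrand on \<open>t\<close>. Integrands at
  different times thus agree on the common interval, as the submartingale inequality
  requires.\<close>

lemma N_wiener_int:
  assumes "0 \<le> t" "t < 1"
  shows "wiener_int t (\<lambda>s. indicator {0<..t} s * (1 - s) powr (- \<alpha>)) (N t)"
proof -
  have "(1 - t) powr (- \<alpha>) * (indicator {0<..t} s * ((1 - t) / (1 - s)) powr \<alpha>) =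
      indicator {0<..t} s * (1 - s) powr (- \<alpha>)" for s
  proof (cases "s \<in> {0<..t}")
    case True
    thus ?thesis using assms by (simp add: powr_divide powr_minus field_simps)
  qed simp
  thus ?thesis
    using wiener_int_cmult[OF X_wiener_int[OF assms], of "(1 - t) powr (- \<alpha>)"]
    unfolding N_def[abs_def] by (simp only:)
qed

lemma N_sq_integrable: "0 \<le> t \<Longrightarrow> t < 1 \<Longrightarrow> sq_integrable M (N t)"
  using wiener_int_sq_integrable(2)[OF N_wiener_int] by simp

text \<open>The mean of the positive part of a centred normal variable with variance
  \<open>1 / (1 - 2\<alpha>)\<close>, the limiting variance of \<open>N t\<close> as
  \<open>t\<close> tends to 1.\<close>

definition bound :: real where
  "bound = 1 / sqrt (2 * pi * (1 - 2 * \<alpha>))"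

lemma bound_pos: "bound > 0"
  using \<alpha> by (simp add: bound_def)

lemma N_pos_part_le:
  assumes t: "0 \<le> t" "t < 1"
  shows "expectation (\<lambda>\<omega>. max 0 (N t \<omega>)) \<le> bound"
proof -
  have "max 0 (N t \<omega>) = (1 - t) powr (- \<alpha>) * max 0 (X t \<omega>)" for \<omega>
    using t by (simp add: N_def max_mult_distrib_left)
  hence "expectation (\<lambda>\<omega>. max 0 (N t \<omega>)) = (1 - t) powr (- \<alpha>) * expectation (\<lambda>\<omega>. max 0 (X t \<omega>))"
    by simp
  also have "\<dots> \<le> (1 - t) powr (- \<alpha>) * (L2_norm M (X t) / sqrt (2 * pi))"
    using has_wiener_integral_pos_part[OF X_integral] t by (intro mult_left_mono) auto
  also have "\<dots> = L2_norm M (N t) / sqrt (2 * pi)"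
    unfolding N_def[abs_def] L2_norm_cmult by simp
  also have "\<dots> \<le> (1 / sqrt (1 - 2 * \<alpha>)) / sqrt (2 * pi)"
    using wiener_int_isometry[OF N_wiener_int] L2_norm_weight_le[OF \<alpha> t] t
    by (intro divide_right_mono) auto
  also have "\<dots> = bound"
    unfolding bound_def real_sqrt_mult[of "2 * pi"] by simp
  finally show ?thesis .
qed

lemma sets_natural_filtration_mono:
  assumes "s \<le> t"
  shows "sets (\<F> s) \<subseteq> sets (\<F> t)"
  unfolding sets_natural_filtration using assms by (intro sigma_sets_mono') fastforce

section \<open>Upper bound: optional stopping on refining grids\<close>

context
  fixes \<tau> assumes \<tau>: "\<tau> \<in> stopping_times M W"
begin

lemma \<tau>_range: "\<omega> \<in> space M \<Longrightarrow> 0 \<le> \<tau> \<omega> \<and> \<tau> \<omega> \<le> 1"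
  using \<tau> by (auto simp: stopping_times_def)

text \<open>The event that \<open>\<tau>\<close>, rounded up to a multiple of \<open>1 / n\<close>,
  equals \<open>i / n\<close>. Rounding up, not down, keeps it in the past of time
  \<open>i / n\<close>.\<close>

definition cell :: "nat \<Rightarrow> nat \<Rightarrow> 'a set" where
  "cell n i = {\<omega> \<in> space M. \<lceil>real n * \<tau> \<omega>\<rceil> = int i}"

lemma cell_sets:
  assumes "n > 0"
  shows "cell n i \<in> sets (\<F> (real i / real n))"
proof -
  have le: "{\<omega> \<in> space M. \<tau> \<omega> \<le> t} \<in> sets (\<F> t)" for t
  proof -
    have "stopping_time \<F> \<tau>"
      using \<tau> by (auto simp: stopping_times_def)
    from stopping_timeD[OF this, of t] show ?thesis
      by (simp add: Measurable.pred_def)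
  qed
  have "cell n i = {\<omega> \<in> space M. \<tau> \<omega> \<le> real i / real n} - {\<omega> \<in> space M. \<tau> \<omega> \<le> (real i - 1) / real n}"
    using assms by (auto simp: cell_def ceiling_eq_iff field_simps)
  moreover have "{\<omega> \<in> space M. \<tau> \<omega> \<le> (real i - 1) / real n} \<in> sets (\<F> (real i / real n))"
    by (rule subsetD[OF sets_natural_filtration_mono le]) (simp add: divide_right_mono)
  ultimately show ?thesis
    using le by auto
qed

text \<open>The positive part of \<open>N\<close> at the rounded time. The index \<open>n\<close> is
  left out: if \<open>\<tau>\<close> is rounded up to 1, the value is 0.\<close>

definition discretised :: "nat \<Rightarrow> 'a \<Rightarrow> real" where
  "discretised n \<omega> = (\<Sum>i<n. indicator (cell n i) \<omega> * max 0 (N (real i / real n) \<omega>))"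

text \<open>Discrete optional stopping: on each cell the submartingale inequality moves the time to
  the last grid point \<open>T\<close> before 1. The cells are disjoint, so the sum is at most the
  mean of the positive part of \<open>N T\<close>.\<close>

lemma
  assumes n: "n > 0"
  shows discretised_integrable: "integrable M (discretised n)"
    and discretised_expectation: "expectation (discretised n) \<le> bound"
proof -
  define T where "T = real (n - 1) / real n"
  have T: "0 \<le> T" "T < 1"
    using n by (auto simp: T_def)
  have cell: "cell n i \<in> sets M" for i
    using cell_sets[OF n] sets_natural_filtration_subset by blast
  have int: "integrable M (\<lambda>\<omega>. indicator (cell n i) \<omega> * max 0 (N s \<omega>))" if "0 \<le> s" "s < 1" for s i
    using that by (intro integrable_indicator_mult sq_integrable_pos_part N_sq_integrable cell)
  show "integrable M (discretised n)"
    unfolding discretised_def[abs_def] using n by (intro Bochner_Integration.integrable_sum int) auto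
  have "expectation (discretised n) = (\<Sum>i<n. expectation (\<lambda>\<omega>. indicator (cell n i) \<omega> * max 0 (N (real i / real n) \<omega>)))"
    unfolding discretised_def[abs_def] using n by (intro Bochner_Integration.integral_sum int) auto
  also have "\<dots> \<le> (\<Sum>i<n. expectation (\<lambda>\<omega>. indicator (cell n i) \<omega> * max 0 (N T \<omega>)))"
  proof (rule sum_mono)
    fix i assume "i \<in> {..<n}"
    hence i: "0 \<le> real i / real n" "real i / real n \<le> T" "real i / real n < 1"
      by (auto simp: T_def intro!: divide_right_mono)
    show "expectation (\<lambda>\<omega>. indicator (cell n i) \<omega> * max 0 (N (real i / real n) \<omega>)) \<le>
        expectation (\<lambda>\<omega>. indicator (cell n i) \<omega> * max 0 (N T \<omega>))"
      using i T cell_sets[OF n, of i]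
      by (intro wiener_int_submartingale[OF N_wiener_int[OF i(1,3)] N_wiener_int[OF T] i(1,2)])
         (auto simp: indicator_def)
  qed
  also have "\<dots> = expectation (\<lambda>\<omega>. \<Sum>i<n. indicator (cell n i) \<omega> * max 0 (N T \<omega>))"
    using T by (intro Bochner_Integration.integral_sum[symmetric] int)
  also have "\<dots> \<le> expectation (\<lambda>\<omega>. max 0 (N T \<omega>))"
  proof (rule integral_mono)
    show "integrable M (\<lambda>\<omega>. \<Sum>i<n. indicator (cell n i) \<omega> * max 0 (N T \<omega>))"
      using T by (intro Bochner_Integration.integrable_sum int)
    show "integrable M (\<lambda>\<omega>. max 0 (N T \<omega>))"
      using T by (intro sq_integrable_imp_integrable sq_integrable_pos_part N_sq_integrable)
    fix \<omega> assume "\<omega> \<in> space M"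
    have "(\<Sum>i<n. indicator (cell n i) \<omega> :: real) \<le> (\<Sum>i<n. if i = nat \<lceil>real n * \<tau> \<omega>\<rceil> then 1 else 0)"
      by (intro sum_mono) (auto simp: cell_def indicator_def)
    also have "\<dots> \<le> 1"
      by (simp add: sum.delta)
    finally have "(\<Sum>i<n. indicator (cell n i) \<omega>) * max 0 (N T \<omega>) \<le> 1 * max 0 (N T \<omega>)"
      by (rule mult_right_mono) auto
    thus "(\<Sum>i<n. indicator (cell n i) \<omega> * max 0 (N T \<omega>)) \<le> max 0 (N T \<omega>)"
      by (simp add: sum_distrib_right)
  qed
  also have "\<dots> \<le> bound"
    by (rule N_pos_part_le[OF T])
  finally show "expectation (discretised n) \<le> bound" .
qed

lemma discretised_nonneg: "discretised n \<omega> \<ge> 0"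
  by (auto simp: discretised_def intro!: sum_nonneg)

lemma discretised_tendsto:
  assumes \<omega>: "\<omega> \<in> space M" and less: "\<tau> \<omega> < 1"
  shows "(\<lambda>n. discretised n \<omega>) \<longlonglongrightarrow> max 0 (N (\<tau> \<omega>) \<omega>)"
proof -
  have \<tau>0: "0 \<le> \<tau> \<omega>" using \<tau>_range[OF \<omega>] by simp
  \<comment> \<open>\<open>r n\<close> is the rounded time. As \<open>\<tau> \<omega> < 1\<close>,
    it is eventually below 1, where the path is continuous and the sum has exactly one active
    cell.\<close>
  define r where "r = (\<lambda>n. real (nat \<lceil>real n * \<tau> \<omega>\<rceil>) / real n)"
  have r: "r \<longlonglongrightarrow> \<tau> \<omega>"
  proof (rule tendsto_sandwich[where f = "\<lambda>_. \<tau> \<omega>" and h = "\<lambda>n. \<tau> \<omega> + 1 / real n"])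
    show "(\<lambda>n. \<tau> \<omega> + 1 / real n) \<longlonglongrightarrow> \<tau> \<omega>"
      using tendsto_add[OF tendsto_const[of "\<tau> \<omega>"] lim_1_over_n] by simp
    show "\<forall>\<^sub>F n in sequentially. \<tau> \<omega> \<le> r n"
      using eventually_gt_at_top[of 0]
    proof eventually_elim
      case (elim n)
      have "real n * \<tau> \<omega> \<le> real (nat \<lceil>real n * \<tau> \<omega>\<rceil>)"
        by (rule real_nat_ceiling_ge)
      thus ?case using elim by (simp add: r_def field_simps)
    qed
    show "\<forall>\<^sub>F n in sequentially. r n \<le> \<tau> \<omega> + 1 / real n"
      using eventually_gt_at_top[of 0]
    proof eventually_elim
      case (elim n)
      have "real (nat \<lceil>real n * \<tau> \<omega>\<rceil>) = of_int \<lceil>real n * \<tau> \<omega>\<rceil>"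
        using \<tau>0 by simp
      also have "\<dots> \<le> real n * \<tau> \<omega> + 1"
        by linarith
      finally show ?case using elim by (simp add: r_def field_simps)
    qed
  qed simp
  have ev: "\<forall>\<^sub>F n in sequentially. n > 0 \<and> r n \<in> {0..<1}"
    using eventually_gt_at_top[of 0] order_tendstoD(2)[OF r less] by eventually_elim (auto simp: r_def)
  have "continuous_on {0..<1} (\<lambda>t. max 0 (N t \<omega>))"
    unfolding N_def by (intro continuous_intros X_continuous \<omega>) auto
  moreover have "\<forall>\<^sub>F n in sequentially. r n \<in> {0..<1}"
    using ev by eventually_elim simp
  ultimately have "(\<lambda>n. max 0 (N (r n) \<omega>)) \<longlonglongrightarrow> max 0 (N (\<tau> \<omega>) \<omega>)"
    using \<tau>0 less by (intro continuous_on_tendsto_compose[OF _ r]) auto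
  moreover have "\<forall>\<^sub>F n in sequentially. max 0 (N (r n) \<omega>) = discretised n \<omega>"
    using ev
  proof eventually_elim
    case (elim n)
    define j where "j = nat \<lceil>real n * \<tau> \<omega>\<rceil>"
    have j: "j < n" "r n = real j / real n"
      using elim by (auto simp: r_def j_def)
    have "\<lceil>real n * \<tau> \<omega>\<rceil> \<ge> 0"
      using ceiling_mono[of 0 "real n * \<tau> \<omega>"] \<tau>0 by simp
    hence "indicator (cell n i) \<omega> = (if i = j then 1 else 0 :: real)" for i
      using \<omega> by (auto simp: cell_def j_def indicator_def)
    hence "discretised n \<omega> = (\<Sum>i<n. if i = j then max 0 (N (real i / real n) \<omega>) else 0)"
      unfolding discretised_def by (intro sum.cong) auto
    thus ?case
      using j by (simp add: sum.delta)
  qed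
  ultimately show ?thesis
    by (rule Lim_transform_eventually)
qed

text \<open>Fatou's lemma applied to the discretised values, using
  \<open>X \<le> (1 - t) powr (- \<alpha>) X\<close> for nonnegative \<open>X\<close>. At
  \<open>\<tau> = 1\<close> the payoff is 0.\<close>

lemma stopped_expectation_le: "expectation (\<lambda>\<omega>. X (\<tau> \<omega>) \<omega>) \<le> bound"
proof (cases "integrable M (\<lambda>\<omega>. X (\<tau> \<omega>) \<omega>)")
  \<comment> \<open>The integral is then 0 by convention, which is below the bound. In the other
    case integrability also supplies the measurability of the stopped value.\<close>
  case False
  thus ?thesis
    using bound_pos by (simp add: not_integrable_integral_eq)
next
  case True
  hence int: "integrable M (\<lambda>\<omega>. max 0 (X (\<tau> \<omega>) \<omega>))"
    by auto
  have "ennreal (expectation (\<lambda>\<omega>. max 0 (X (\<tau> \<omega>) \<omega>))) = (\<integral>\<^sup>+\<omega>. ennreal (max 0 (X (\<tau> \<omega>) \<omega>)) \<partial>M)"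
    using int by (intro nn_integral_eq_integral[symmetric]) auto
  also have "\<dots> \<le> (\<integral>\<^sup>+\<omega>. liminf (\<lambda>n. ennreal (discretised n \<omega>)) \<partial>M)"
  proof (rule nn_integral_mono)
    fix \<omega> assume \<omega>: "\<omega> \<in> space M"
    show "ennreal (max 0 (X (\<tau> \<omega>) \<omega>)) \<le> liminf (\<lambda>n. ennreal (discretised n \<omega>))"
    proof (cases "\<tau> \<omega> < 1")
      case False
      hence "\<tau> \<omega> = 1" using \<tau>_range[OF \<omega>] by simp
      thus ?thesis using X_1[OF \<omega>] by simp
    next
      case True
      have "(1 - \<tau> \<omega>) powr (- \<alpha>) \<ge> 1"
        using powr_mono2'[of "- \<alpha>" "1 - \<tau> \<omega>" 1] True \<tau>_range[OF \<omega>] \<alpha> by simp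
      hence "1 * max 0 (X (\<tau> \<omega>) \<omega>) \<le> (1 - \<tau> \<omega>) powr (- \<alpha>) * max 0 (X (\<tau> \<omega>) \<omega>)"
        by (rule mult_right_mono) auto
      also have "\<dots> = max 0 (N (\<tau> \<omega>) \<omega>)"
        by (simp add: N_def max_mult_distrib_left)
      finally have "ennreal (max 0 (X (\<tau> \<omega>) \<omega>)) \<le> ennreal (max 0 (N (\<tau> \<omega>) \<omega>))"
        unfolding mult_1 by (rule ennreal_leI)
      also have "\<dots> = liminf (\<lambda>n. ennreal (discretised n \<omega>))"
        by (intro lim_imp_Liminf[symmetric] tendsto_ennrealI discretised_tendsto \<omega> True) auto
      finally show ?thesis .
    qed
  qed
  \<comment> \<open>The shift skips \<open>n = 0\<close>, for which there is no grid.\<close>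
  also have "\<dots> = (\<integral>\<^sup>+\<omega>. liminf (\<lambda>n. ennreal (discretised (Suc n) \<omega>)) \<partial>M)"
    by (intro nn_integral_cong) (rule liminf_shift[unfolded Suc_eq_plus1[symmetric], symmetric])
  also have "\<dots> \<le> liminf (\<lambda>n. \<integral>\<^sup>+\<omega>. ennreal (discretised (Suc n) \<omega>) \<partial>M)"
    using discretised_integrable by (intro nn_integral_liminf) auto
  also have "\<dots> \<le> liminf (\<lambda>n. ennreal bound)"
  proof (intro Liminf_mono always_eventually allI)
    fix n
    have "(\<integral>\<^sup>+\<omega>. ennreal (discretised (Suc n) \<omega>) \<partial>M) = ennreal (expectation (discretised (Suc n)))"
      using discretised_integrable discretised_nonneg by (intro nn_integral_eq_integral) auto
    also have "\<dots> \<le> ennreal bound"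
      by (intro ennreal_leI discretised_expectation) simp
    finally show "(\<integral>\<^sup>+\<omega>. ennreal (discretised (Suc n) \<omega>) \<partial>M) \<le> ennreal bound" .
  qed
  also have "\<dots> = ennreal bound"
    by (simp add: Liminf_const)
  finally have "expectation (\<lambda>\<omega>. max 0 (X (\<tau> \<omega>) \<omega>)) \<le> bound"
    using bound_pos by (simp add: ennreal_le_iff)
  moreover have "expectation (\<lambda>\<omega>. X (\<tau> \<omega>) \<omega>) \<le> expectation (\<lambda>\<omega>. max 0 (X (\<tau> \<omega>) \<omega>))"
    using True int by (intro integral_mono) auto
  ultimately show ?thesis by simp
qed

end

lemma stopping_value_le: "stopping_value M W X \<le> ereal (1 / sqrt (2 * pi * (1 - 2 * \<alpha>)))"
  unfolding stopping_value_def bound_def[symmetric]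
  by (intro SUP_least) (simp add: stopped_expectation_le)

text \<open>The rule decides by the sign of \<open>W t\<close>, an event of the uncompleted natural
  filtration; \<open>X t\<close> is only a version of an integral, but close to \<open>W t\<close>.
  Continuing to time 1 pays 0.\<close>

lemma stopping_value_ge:
  "stopping_value M W X \<ge> ereal (sqrt (1 - \<alpha>) / sqrt (2 * pi) - (1 - \<alpha> powr \<alpha>))"
proof -
  \<comment> \<open>This choice balances two demands: \<open>t\<close> tends to 1, while the
    integrand of \<open>X t\<close>, which is at least
    \<open>(1 - t) powr \<alpha> = \<alpha> powr \<alpha>\<close>, still tends to 1.\<close>
  define t where "t = 1 - \<alpha>"
  have t: "0 < t" "t < 1" using \<alpha> by (auto simp: t_def)
  define A where "A = {\<omega> \<in> space M. W t \<omega> > 0}"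
  define \<tau> where "\<tau> = (\<lambda>\<omega>. if W t \<omega> > 0 then t else 1)"
  have A_t: "A \<in> sets (\<F> t)"
  proof -
    have "A = W t -` {0<..} \<inter> space (\<F> t)"
      by (auto simp: A_def)
    also have "\<dots> \<in> sets (\<F> t)"
      using t by (intro measurable_sets[OF W_adapted]) auto
    finally show ?thesis .
  qed
  hence A: "A \<in> sets M"
    using sets_natural_filtration_subset by auto
  have "{\<omega> \<in> space M. \<tau> \<omega> \<le> s} \<in> sets (\<F> s)" for s
  proof -
    consider "s < t" | "t \<le> s" "s < 1" | "1 \<le> s" by linarith
    thus ?thesis
    proof cases
      case 1
      hence "{\<omega> \<in> space M. \<tau> \<omega> \<le> s} = {}"
        using t by (auto simp: \<tau>_def)
      thus ?thesis by (metis sets.empty_sets)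
    next
      case 2
      hence "{\<omega> \<in> space M. \<tau> \<omega> \<le> s} = A"
        by (auto simp: \<tau>_def A_def)
      thus ?thesis using A_t sets_natural_filtration_mono[OF 2(1)] by auto
    next
      case 3
      hence "{\<omega> \<in> space M. \<tau> \<omega> \<le> s} = space (\<F> s)"
        using t by (auto simp: \<tau>_def)
      thus ?thesis by (metis sets.top)
    qed
  qed
  hence "stopping_time \<F> \<tau>"
    by (simp add: stopping_time_def Measurable.pred_def)
  hence \<tau>: "\<tau> \<in> stopping_times M W"
    using t unfolding stopping_times_def by (simp add: \<tau>_def)
  \<comment> \<open>On \<open>{0<..t}\<close> the integrand of \<open>X t\<close> lies between
    \<open>\<alpha> powr \<alpha>\<close> and 1, the integrand of \<open>W t\<close>; so
    \<open>d\<close> bounds their difference.\<close>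
  define d where "d = 1 - \<alpha> powr \<alpha>"
  have d: "d \<ge> 0"
    using \<alpha> powr_le1[of \<alpha> \<alpha>] by (simp add: d_def)
  have X_t: "wiener_int t (\<lambda>s. indicator {0<..t} s * ((1 - t) / (1 - s)) powr \<alpha>) (X t)"
    using t by (intro X_wiener_int) auto
  have W_t: "wiener_int t (indicator {0<..t}) (W t)"
    using t by (intro wiener_int_pair wiener_pair.base) auto
  note XW = wiener_int_diff[OF X_t W_t]
  have sq: "sq_integrable M (X t)" "sq_integrable M (W t)"
    using wiener_int_sq_integrable(2)[OF X_t] wiener_int_sq_integrable(2)[OF W_t] t by auto
  have "L2_norm M (\<lambda>\<omega>. X t \<omega> - W t \<omega>) =
      L2_norm lborel (\<lambda>s. indicator {0<..t} s * ((1 - t) / (1 - s)) powr \<alpha> - indicator {0<..t} s)"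
    using t by (intro wiener_int_isometry[OF XW]) auto
  also have "\<dots> \<le> L2_norm lborel (\<lambda>s. d * indicator {0<..1 :: real} s)"
  proof (rule L2_norm_mono)
    show "sq_integrable lborel (\<lambda>s. d * indicator {0<..1::real} s)"
      by (intro sq_integrable_cmult sq_integrable_indicator)
    show "(\<lambda>s. indicator {0<..t} s * ((1 - t) / (1 - s)) powr \<alpha> - indicator {0<..t} s) \<in> borel_measurable lborel"
      using wiener_int_sq_integrable(1)[OF XW] t by (simp add: sq_integrable_def)
    show "AE s in lborel. \<bar>indicator {0<..t} s * ((1 - t) / (1 - s)) powr \<alpha> - indicator {0<..t} s\<bar> \<le> \<bar>d * indicator {0<..1} s\<bar>"
    proof (rule AE_I2)
      fix s :: real
      show "\<bar>indicator {0<..t} s * ((1 - t) / (1 - s)) powr \<alpha> - indicator {0<..t} s\<bar> \<le> \<bar>d * indicator {0<..1} s\<bar>"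
      proof (cases "s \<in> {0<..t}")
        case True
        hence s: "\<alpha> \<le> 1 - s" "1 - s \<le> 1" "s \<le> 1"
          using t by (auto simp: t_def)
        hence "\<alpha> \<le> \<alpha> / (1 - s)" "\<alpha> / (1 - s) \<le> 1"
          using \<alpha> by (auto simp: field_simps)
        hence "\<alpha> powr \<alpha> \<le> (\<alpha> / (1 - s)) powr \<alpha>" "(\<alpha> / (1 - s)) powr \<alpha> \<le> 1"
          using \<alpha> s by (auto intro!: powr_mono2 powr_le1)
        thus ?thesis using True d s by (simp add: t_def d_def)
      qed auto
    qed
  qed
  also have "\<dots> = d"
  proof -
    have "(indicator {0<..1} s :: real)\<^sup>2 = indicator {0<..1} s" for s :: real
      by (simp add: indicator_def)
    thus ?thesis using d unfolding L2_norm_cmult by (simp add: L2_norm_def)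
  qed
  finally have diff: "L2_norm M (\<lambda>\<omega>. X t \<omega> - W t \<omega>) \<le> d" .
  \<comment> \<open>The normal law is given for increments, so \<open>W 0 = 0\<close> is used almost
    surely.\<close>
  have "expectation (\<lambda>\<omega>. indicator A \<omega> * W t \<omega>) = expectation (\<lambda>\<omega>. max 0 (W t \<omega> - W 0 \<omega>))"
  proof (rule integral_cong_AE)
    show "AE \<omega> in M. indicator A \<omega> * W t \<omega> = max 0 (W t \<omega> - W 0 \<omega>)"
      using W_0 AE_space by eventually_elim (auto simp: A_def indicator_def)
  qed (use A t in auto)
  also have "\<dots> = sqrt t / sqrt (2 * pi)"
    using normal_expectation_pos_part[OF W_normal[of 0 t]] t by simp
  finally have W_exp: "expectation (\<lambda>\<omega>. indicator A \<omega> * W t \<omega>) = sqrt t / sqrt (2 * pi)" .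
  have "\<bar>expectation (\<lambda>\<omega>. indicator A \<omega> * X t \<omega>) - expectation (\<lambda>\<omega>. indicator A \<omega> * W t \<omega>)\<bar>
      \<le> L2_norm M (\<lambda>\<omega>. X t \<omega> - W t \<omega>)"
    by (rule expectation_diff_le_L2_norm[OF integrable_indicator_mult[OF sq(1) A]
          integrable_indicator_mult[OF sq(2) A] sq_integrable_diff[OF sq]])
       (simp add: indicator_def)
  hence "sqrt t / sqrt (2 * pi) - d \<le> expectation (\<lambda>\<omega>. indicator A \<omega> * X t \<omega>)"
    using diff W_exp by linarith
  also have "\<dots> = expectation (\<lambda>\<omega>. X (\<tau> \<omega>) \<omega>)"
    by (intro Bochner_Integration.integral_cong) (auto simp: A_def \<tau>_def X_1)
  finally show ?thesis
    unfolding stopping_value_def using \<tau> by (intro SUP_upper2[of \<tau>]) (auto simp: t_def d_def)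
qed

end

section \<open>The limit of the stopping value by squeezing\<close>

lemma stopping_value_tendsto:
  assumes "brownian_motion M W" and X: "\<And>\<alpha>. \<alpha> > 0 \<Longrightarrow> alpha_bridge M W \<alpha> (X \<alpha>)"
  shows "((\<lambda>\<alpha>. stopping_value M W (X \<alpha>)) \<longlongrightarrow> ereal (1 / sqrt (2 * pi))) (at_right 0)"
proof -
  have bridge: "brownian_bridge M W \<alpha> (X \<alpha>)" if "0 < \<alpha> \<and> \<alpha> < 1/2" for \<alpha>
    using assms that
    by (auto simp: brownian_bridge_def brownian_bridge_axioms_def brownian_def brownian_axioms_def brownian_motion_def)
  show ?thesis
  proof (rule tendsto_sandwich)
    show "\<forall>\<^sub>F \<alpha> in at_right 0. ereal (sqrt (1 - \<alpha>) / sqrt (2 * pi) - (1 - \<alpha> powr \<alpha>)) \<le> stopping_value M W (X \<alpha>)"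
      using eventually_small by eventually_elim (rule brownian_bridge.stopping_value_ge[OF bridge])
    show "\<forall>\<^sub>F \<alpha> in at_right 0. stopping_value M W (X \<alpha>) \<le> ereal (1 / sqrt (2 * pi * (1 - 2 * \<alpha>)))"
      using eventually_small by eventually_elim (rule brownian_bridge.stopping_value_le[OF bridge])
    have "((\<lambda>\<alpha>::real. \<alpha> powr \<alpha>) \<longlongrightarrow> 1) (at_right 0)"
      by real_asymp
    hence "((\<lambda>\<alpha>::real. sqrt (1 - \<alpha>) / sqrt (2 * pi) - (1 - \<alpha> powr \<alpha>)) \<longlongrightarrow>
        sqrt (1 - 0) / sqrt (2 * pi) - (1 - 1)) (at_right 0)"
      by (intro tendsto_intros) auto
    thus "((\<lambda>\<alpha>. ereal (sqrt (1 - \<alpha>) / sqrt (2 * pi) - (1 - \<alpha> powr \<alpha>))) \<longlongrightarrow> ereal (1 / sqrt (2 * pi))) (at_right 0)"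
      by simp
    have "((\<lambda>\<alpha>::real. 1 / sqrt (2 * pi * (1 - 2 * \<alpha>))) \<longlongrightarrow> 1 / sqrt (2 * pi * (1 - 2 * 0))) (at_right 0)"
      by (intro tendsto_intros) auto
    thus "((\<lambda>\<alpha>. ereal (1 / sqrt (2 * pi * (1 - 2 * \<alpha>)))) \<longlongrightarrow> ereal (1 / sqrt (2 * pi))) (at_right 0)"
      by simp
  qed
qed

theorem theorem2:
  fixes M :: "'a measure" and W :: "real \<Rightarrow> 'a \<Rightarrow> real"
    and X :: "real \<Rightarrow> real \<Rightarrow> 'a \<Rightarrow> real"
  assumes "brownian_motion M W"
    and "\<And>\<alpha>. \<alpha> > 0 \<Longrightarrow> alpha_bridge M W \<alpha> (X \<alpha>)"
  shows "filterlim B at_top (at_right 0) \<and>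
    (C \<longlongrightarrow> 1/2) (at_right 0) \<and>
    ((\<lambda>\<alpha>. stopping_value M W (X \<alpha>)) \<longlongrightarrow> ereal (1 / sqrt (2 * pi))) (at_right 0)"
  using B_at_top C_tendsto stopping_value_tendsto[OF assms] by blast

end
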